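(* Let $(\phi_h,\mu_h,\mathbf{u}_h,\pi_h,\theta_h)$ be any solution of the fully discrete scheme stated in the context. Then for every $n\in\{0,\dots,n_T-1\}$ discrete mass and total energy are conserved and entropy is produced, i.e. \begin{align*} &\langle \phi^{n+1}_h -\phi^0_h,1 \rangle = 0 ,\qquad \left\langle \tfrac{1}{2}|\mathbf{u}^{n+1}_h|^2 + e(\phi_h^{n+1},\theta_h^{n+1}) - \tfrac{1}{2}|\mathbf{u}^{0}_h|^2 - e(\phi_h^{0},\theta_h^{0}),1 \right\rangle = 0, \\ &\langle s(\phi_h^{n+1},\theta_h^{n+1}) - s(\phi_h^{0},\theta_h^{0}),1\rangle = \tau\sum_{k=0}^{n}\mathcal{D}^{*}_{\theta^{k+1}_h,\mathbf{L}^*}(\mathrm{D}\mathbf{u}^{k+1/2}_h,\nabla\mu_h^{k+1},\nabla\theta_h^{k+1}) + \sum_{k=0}^{n}\mathcal{D}_{num}^k, \end{align*} where $$\mathcal{D}^*_{\theta_h^{k+1},\mathbf{L}^*}(\mathrm{D}\mathbf{u}^{k+1/2}_h,\nabla\mu_h^{k+1},\nabla\theta_h^{k+1})=\left\|\sqrt{\eta^*\theta_h^{k+1}}\,\mathrm{D}\mathbf{u}_h^{k+1/2}\right\|_0^2+\left\langle(\nabla\mu_h^{k+1},\nabla\theta_h^{k+1})^\top,\mathbf{L}^*(\nabla\mu_h^{k+1},\nabla\theta_h^{k+1})^\top\right\rangle$$ (with $\eta^*,\mathbf{L}^*$ those of the $k$-th step, from $t^k$ to $t^{k+1}$), and where the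 numerical dissipation satisfies $\mathcal{D}_{num}^k\geq0$ and is given by \begin{align*} \mathcal{D}_{num}^k = \int_\Omega &\tfrac{\gamma}{2}|\nabla d^{k+1}\phi_h|^2 - \tfrac12\partial_{\theta\theta}\Psi(\phi^k_h,\xi^3_h)(d^{k+1}\theta_h)^2 \\ &+ \tfrac12\left(\partial_{\phi\phi}\Psi_{vex}(\xi^1_h,\theta^{k+1}_h) - \partial_{\phi\phi}\Psi_{cav}(\xi^2_h,\theta^{k+1}_h)\right)(d^{k+1}\phi_h)^2 , \end{align*} for some functions $\xi^1_h,\xi^2_h$ which are (pointwise) convex combinations of $\phi_h^{k+1},\phi_h^k$ and some $\xi^3_h$ which is a (pointwise) convex combination of $\theta_h^{k+1},\theta_h^k$.
   Context: Setting: $d\in\{2,3\}$, $\Omega\subset\mathbb{R}^d$ is a square/cube identified with the $d$-dimensional torus; all functions on $\Omega$ are periodic. $\langle u,v\rangle=\int_\Omega u\cdot v$ is the $L^2(\Omega)$ scalar product with norm $\|\cdot\|_0$. $\mathrm{D}\mathbf{u}=\tfrac12(\nabla\mathbf{u}+\nabla\mathbf{u}^\top)$. Constitutive relations: $\tilde\Psi(\phi,\theta)=\Psi(\phi,\theta)+\tfrac{\gamma}{2}|\nabla\phi|^2$, $\boldsymbol{\sigma}=\tfrac{\gamma}{\theta}\nabla\phi\otimes\nabla\phi$, $e(\phi,\theta)=\partial_\theta\tilde\Psi=\partial_\theta\Psi(\phi,\theta)$, $s(\phi,\theta)=\theta e-\tilde\Psi$ (containing the term $-\tfrac{\gamma}{2}|\nabla\phi|^2$).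 Skew-symmetric form: $\mathbf{c}(\mathbf{u},\mathbf{v},\mathbf{w})=\langle(\mathbf{u}\cdot\nabla)\mathbf{v},\mathbf{w}\rangle$, $\mathbf{c}_{skw}(\mathbf{u},\mathbf{v},\mathbf{w})=\tfrac12\mathbf{c}(\mathbf{u},\mathbf{v},\mathbf{w})-\tfrac12\mathbf{c}(\mathbf{u},\mathbf{w},\mathbf{v})$. Standing assumptions: (A1) $\gamma$ is a positive constant. (A2) The viscosity function $\eta=\eta(\phi,\theta)$ is strictly positive. (A3) The diffusion matrix $\mathbf{L}=\mathbf{L}(\phi,\nabla\phi,\theta)=\begin{pmatrix}\mathbf{L}_{11}&-\mathbf{L}_{12}\\-\mathbf{L}_{12}&\mathbf{L}_{22}\end{pmatrix}\in\mathbb{R}^{2d\times2d}$ (with $d\times d$ blocks) is symmetric and strictly positive definite, and $\mathbf{L}_{12}$ is symmetric. (A4) $\Psi:\mathbb{R}\times\mathbb{R}_+\to\mathbb{R}$, $\mathbb{R}_+=(0,\infty)$: for every fixed $\phi$, $\Psi(\phi,\cdot)$ is concave and $|\Psi(\phi,\theta)|\to\infty$ as $\theta\to0$; for every fixed $\theta$, $\Psi(\cdot,\theta)=\Psi_{vex}(\cdot,\theta)+\Psi_{cav}(\cdot,\theta)$ with $\Psi_{vex}(\cdot,\theta)$ strictly convex and $\Psi_{cav}(\cdot,\theta)$ strictly concave. Moreover $\Psi,\Psi_{vex},\Psi_{cav}$ are $C^2$ and $\eta,\mathbf{L}$ are $C^1$ functions of their arguments. Time discretization: $[0,T]$ is partitioned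 uniformly with step $\tau>0$, $\mathcal{I}_\tau=\{t^0=0,t^1=\tau,\dots,t^{n_T}=T\}$, $n_T=T/\tau$. $\Pi^1_c(\mathcal{I}_\tau;X)$ and $\Pi^0(\mathcal{I}_\tau;X)$ are the continuous piecewise linear, resp. piecewise constant, functions on $\mathcal{I}_\tau$ with values in $X$. $g^n$ is the value at time level $n$, $g^{n+1/2}=(g^{n+1}+g^n)/2$, $d^{n+1}g=g^{n+1}-g^n$, $d^{n+1}_\tau g=\tau^{-1}d^{n+1}g$. Space discretization: $\mathcal{T}_h$ is a geometrically conforming partition of $\Omega$ into simplices that extends periodically to periodic extensions of $\Omega$; $P_k(K)$ denotes polynomials of degree at most $k$ on $K$. With all functions periodic, $\mathcal{V}_h=\{v\in H^1(\Omega)\cap C^0(\bar\Omega): v|_K\in P_1(K)\ \forall K\in\mathcal{T}_h\}$, $\mathcal{X}_h^d=\{v\in H^1(\Omega)^d\cap C^0(\bar\Omega)^d: v|_K\in P_2(K)^d\ \forall K\in\mathcal{T}_h\}$, $\mathcal{Q}_h=\{v\in\mathcal{V}_h:\langle v,1\rangle=0\}$, $\mathcal{V}_h^+=\{v\in\mathcal{V}_h: v(x)>0\ \forall x\in\Omega\}$. Convex-concave splitting: $\Psi_{sp}(\phi_h^{n+1},\phi_h^n,\theta_h^{n+1})=\Psi_{vex}(\phi_h^{n+1},\theta_h^{n+1})+\Psi_{cav}(\phi_h^n,\theta_h^{n+1})$, and $\partial_\phi\Psi_{sp}(\phi_h^{n+1},\phi_h^n,\theta_h^{n+1})=\partial_\phi\Psi_{vex}(\phi_h^{n+1},\theta_h^{n+1})+\partial_\phi\Psi_{cav}(\phi_h^n,\theta_h^{n+1})$.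 Abbreviate $e_h^{n}=e(\phi_h^n,\theta_h^n)$, and similarly for $s,\Psi$. Fully discrete scheme: given $(\phi_h^0,\mathbf{u}_h^0,\theta_h^0)\in\mathcal{V}_h\times\mathcal{X}_h^d\times\mathcal{V}_h^+$, find $(\phi_h,\mathbf{u}_h,\theta_h)\in\Pi^1_c(\mathcal{I}_\tau;\mathcal{V}_h\times\mathcal{X}_h^d\times\mathcal{V}_h^+)$ and $(\mu_h,\pi_h)\in\Pi^0(\mathcal{I}_\tau;\mathcal{V}_h\times\mathcal{Q}_h)$ such that for every $n\in\{0,\dots,n_T-1\}$ \begin{align*} 0&=\langle d_\tau^{n+1}\phi_h,\psi_h \rangle - \langle \phi_h^*\mathbf{u}_h^{n+1/2},\nabla\psi_h\rangle + \langle \mathbf{L}_{11}^*\nabla\mu_h^{n+1} - \mathbf{L}_{12}^*\nabla\theta_h^{n+1},\nabla\psi_h \rangle, \\ 0&=\langle \mu_h^{n+1},\xi_h \rangle - \gamma\langle \nabla\phi_h^{n+1},\nabla\xi_h \rangle - \langle \partial_\phi \Psi_{sp}(\phi^{n+1}_h,\phi^{n}_h,\theta^{n+1}_h),\xi_h \rangle, \\ 0&=\langle d_\tau^{n+1}e_h,w_h \rangle - \langle \eta^*|\mathrm{D}\mathbf{u}_h^{n+1/2}|^2, w_h\rangle + \langle \mathbf{L}_{12}^*\nabla\mu_h^{n+1} - \mathbf{L}_{22}^*\nabla\theta_h^{n+1}, \nabla w_h\rangle\\ &\quad - \langle \boldsymbol{\sigma}_h^*\mathbf{u}_h^{n+1/2},\nabla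 w_h\rangle-\left\langle \tfrac{\phi_h^*}{\theta_h^{n+1}}\nabla\mu_h^{n+1} - \boldsymbol{\sigma}_h^*\tfrac{\nabla\theta_h^{n+1}}{\theta_h^{n+1}},\mathbf{u}_h^{n+1/2} w_h \right\rangle \\ &\quad- \left\langle (s_h^*+\phi_h^*\mu_h^* )\mathbf{u}_h^{n+1/2} ,\tfrac{\theta_h^{n+1}\nabla w_h-w_h\nabla\theta_h^{n+1}}{(\theta_h^* )^2} \right\rangle, \\ 0&=\langle d_\tau^{n+1}\mathbf{u}_h,\mathbf{v}_h \rangle + \mathbf{c}_{skw}(\mathbf{u}_h^{*},\mathbf{u}_h^{n+1/2},\mathbf{v}_h) + \langle \eta^*\mathrm{D}\mathbf{u}_h^{n+1/2},\mathrm{D}\mathbf{v}_h \rangle - \langle \pi_h^{n+1},\operatorname{div}(\mathbf{v}_h)\rangle \\ &\quad +\left\langle \tfrac{\phi_h^*}{\theta_h^{n+1}}\nabla\mu_h^{n+1} - \boldsymbol{\sigma}_h^*\tfrac{\nabla\theta_h^{n+1}}{\theta_h^{n+1}} - (s_h^*+\phi_h^*\mu^*_h)\tfrac{\nabla\theta_h^{n+1}}{(\theta_h^* )^2},\mathbf{v}_h \right\rangle, \\ 0 &= \langle \operatorname{div}(\mathbf{u}_h^{n+1/2}),q_h \rangle \end{align*} holds for all $(\psi_h,\xi_h,w_h,\mathbf{v}_h,q_h)\in\mathcal{V}_h\times\mathcal{V}_h\times\mathcal{V}_h^+\times\mathcal{X}_h^d\times\mathcal{Q}_h$. Here $g^*$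 denotes evaluation of $g$ at some $t\in\{t^n,t^{n+1}\}$, the same point in time for all starred terms (if $t=t^n$ is used, an arbitrary $\mu_h^0\in\mathcal{V}_h$ is taken as given for the first step); $\eta^*,\mathbf{L}^*,\boldsymbol{\sigma}_h^*,s_h^*$ are computed from $\phi_h,\theta_h$ at that time. *)

theory Defs
  imports "HOL-Analysis.Analysis"
begin

definition cube :: "real^'d \<Rightarrow> real \<Rightarrow> (real^'d) set" where
  "cube a l = cbox a (\<chi> i. a $ i + l)"

text \<open>Functions on the torus are functions on the whole space with period \<open>l\<close> in each coordinate.\<close>

definition periodic :: "real \<Rightarrow> (real^'d \<Rightarrow> 'b) \<Rightarrow> bool" where
  "periodic l v \<longleftrightarrow> (\<forall>x i. v (x + l *\<^sub>R axis i 1) = v x)"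

text \<open>On vectors and matrices \<open>\<bullet>\<close> is the Euclidean and the Frobenius product respectively.
  The completed Lebesgue measure is used because the classical derivatives of
  finite element functions are unspecified on the null set of element boundaries.\<close>

definition ip :: "(real^'d) set \<Rightarrow> (real^'d \<Rightarrow> 'b::real_inner) \<Rightarrow> (real^'d \<Rightarrow> 'b) \<Rightarrow> real" where
  "ip \<Omega> u v = (LINT x:\<Omega>|lebesgue. u x \<bullet> v x)"

definition norm0 :: "(real^'d) set \<Rightarrow> (real^'d \<Rightarrow> 'b::real_inner) \<Rightarrow> real" where
  "norm0 \<Omega> u = sqrt (ip \<Omega> u u)"

definition grad :: "(real^'d \<Rightarrow> real) \<Rightarrow> real^'d \<Rightarrow> real^'d" where
  "grad v x = (\<chi> i. frechet_derivative v (at x) (axis i 1))"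

definition Dsym :: "(real^'d \<Rightarrow> real^'d) \<Rightarrow> real^'d \<Rightarrow> real^'d^'d" where
  "Dsym u x = (1/2) *\<^sub>R (jacobian u (at x) + transpose (jacobian u (at x)))"

definition dvg :: "(real^'d \<Rightarrow> real^'d) \<Rightarrow> real^'d \<Rightarrow> real" where
  "dvg u x = trace (jacobian u (at x))"

definition cform :: "(real^'d) set \<Rightarrow> (real^'d \<Rightarrow> real^'d) \<Rightarrow> (real^'d \<Rightarrow> real^'d) \<Rightarrow> (real^'d \<Rightarrow> real^'d) \<Rightarrow> real" where
  "cform \<Omega> u v w = ip \<Omega> (\<lambda>x. jacobian v (at x) *v u x) w"

definition cskw :: "(real^'d) set \<Rightarrow> (real^'d \<Rightarrow> real^'d) \<Rightarrow> (real^'d \<Rightarrow> real^'d) \<Rightarrow> (real^'d \<Rightarrow> real^'d) \<Rightarrow> real" where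
  "cskw \<Omega> u v w = (1/2) * cform \<Omega> u v w - (1/2) * cform \<Omega> u w v"

definition outer :: "real^'d \<Rightarrow> real^'d \<Rightarrow> real^'d^'d" where
  "outer a b = (\<chi> i j. a $ i * b $ j)"

definition C1_on :: "'a::real_normed_vector set \<Rightarrow> ('a \<Rightarrow> 'b::real_normed_vector) \<Rightarrow> bool" where
  "C1_on S f \<longleftrightarrow> (\<exists>f' :: 'a \<Rightarrow> 'a \<Rightarrow>\<^sub>L 'b.
     (\<forall>x\<in>S. (f has_derivative blinfun_apply (f' x)) (at x)) \<and> continuous_on S f')"

definition C2_on :: "'a::real_normed_vector set \<Rightarrow> ('a \<Rightarrow> 'b::real_normed_vector) \<Rightarrow> bool" where
  "C2_on S f \<longleftrightarrow> (\<exists>f' :: 'a \<Rightarrow> 'a \<Rightarrow>\<^sub>L 'b.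
     (\<forall>x\<in>S. (f has_derivative blinfun_apply (f' x)) (at x)) \<and> C1_on S f')"

definition strictly_convex_on :: "real set \<Rightarrow> (real \<Rightarrow> real) \<Rightarrow> bool" where
  "strictly_convex_on S f \<longleftrightarrow> convex S \<and>
     (\<forall>x\<in>S. \<forall>y\<in>S. \<forall>r. x \<noteq> y \<and> 0 < r \<and> r < 1 \<longrightarrow>
        f ((1 - r) * x + r * y) < (1 - r) * f x + r * f y)"

definition strictly_concave_on :: "real set \<Rightarrow> (real \<Rightarrow> real) \<Rightarrow> bool" where
  "strictly_concave_on S f \<longleftrightarrow> strictly_convex_on S (\<lambda>x. - f x)"

definition L2_on :: "(real^'d) set \<Rightarrow> (real^'d \<Rightarrow> real) \<Rightarrow> bool" where
  "L2_on \<Omega> f \<longleftrightarrow> set_borel_measurable lebesgue \<Omega> f \<and> set_integrable lebesgue \<Omega> (\<lambda>x. (f x)\<^sup>2)"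

text \<open>Weak derivatives are tested with continuously differentiable functions whose support is
  a compact subset of the open cube.\<close>

definition has_weak_partial :: "(real^'d) set \<Rightarrow> 'd \<Rightarrow> (real^'d \<Rightarrow> real) \<Rightarrow> (real^'d \<Rightarrow> real) \<Rightarrow> bool" where
  "has_weak_partial \<Omega> i v g \<longleftrightarrow>
     (\<forall>\<zeta>. C1_on UNIV \<zeta> \<and> compact (closure {x. \<zeta> x \<noteq> 0}) \<and> closure {x. \<zeta> x \<noteq> 0} \<subseteq> interior \<Omega> \<longrightarrow>
        (LINT x:\<Omega>|lebesgue. v x * grad \<zeta> x $ i) = - (LINT x:\<Omega>|lebesgue. g x * \<zeta> x))"

definition H1_on :: "(real^'d) set \<Rightarrow> (real^'d \<Rightarrow> real) \<Rightarrow> bool" where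
  "H1_on \<Omega> v \<longleftrightarrow> L2_on \<Omega> v \<and> (\<forall>i. \<exists>g. L2_on \<Omega> g \<and> has_weak_partial \<Omega> i v g)"

text \<open>\<open>\<T>\<close> partitions the cube into \<open>d\<close>-simplices; the conformity condition, imposed on all
  lattice translates, says that the periodic extension of \<open>\<T>\<close> is geometrically conforming.\<close>

definition periodic_mesh :: "real^'d \<Rightarrow> real \<Rightarrow> (real^'d) set set \<Rightarrow> bool" where
  "periodic_mesh a l \<T> \<longleftrightarrow>
     finite \<T> \<and> (\<forall>K\<in>\<T>. int CARD('d) simplex K) \<and> \<Union>\<T> = cube a l \<and>
     (\<forall>K\<in>\<T>. \<forall>K'\<in>\<T>. \<forall>z :: int^'d.
        let K'' = (\<lambda>x. x + l *\<^sub>R (\<chi> i. of_int (z $ i))) ` K'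
        in (K \<inter> K'') face_of K \<and> (K \<inter> K'') face_of K'')"

definition poly_deg :: "nat \<Rightarrow> (real^'d \<Rightarrow> real) set" where
  "poly_deg k = {p. \<exists>c :: ('d \<Rightarrow> nat) \<Rightarrow> real.
     \<forall>x. p x = (\<Sum>\<alpha> | (\<Sum>i\<in>UNIV. \<alpha> i) \<le> k. c \<alpha> * (\<Prod>i\<in>UNIV. (x $ i) ^ \<alpha> i))}"

definition fe_space :: "nat \<Rightarrow> real^'d \<Rightarrow> real \<Rightarrow> (real^'d) set set \<Rightarrow> (real^'d \<Rightarrow> real) set" where
  "fe_space k a l \<T> = {v. periodic l v \<and> H1_on (cube a l) v \<and> continuous_on UNIV v \<and>
     (\<forall>K\<in>\<T>. \<exists>p\<in>poly_deg k. \<forall>x\<in>K. v x = p x)}"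

definition Vh :: "real^'d \<Rightarrow> real \<Rightarrow> (real^'d) set set \<Rightarrow> (real^'d \<Rightarrow> real) set" where
  "Vh a l \<T> = fe_space 1 a l \<T>"

definition Xh :: "real^'d \<Rightarrow> real \<Rightarrow> (real^'d) set set \<Rightarrow> (real^'d \<Rightarrow> real^'d) set" where
  "Xh a l \<T> = {v. \<forall>i. (\<lambda>x. v x $ i) \<in> fe_space 2 a l \<T>}"

definition Qh :: "real^'d \<Rightarrow> real \<Rightarrow> (real^'d) set set \<Rightarrow> (real^'d \<Rightarrow> real) set" where
  "Qh a l \<T> = {v \<in> Vh a l \<T>. ip (cube a l) v (\<lambda>_. 1) = 0}"

definition Vhp :: "real^'d \<Rightarrow> real \<Rightarrow> (real^'d) set set \<Rightarrow> (real^'d \<Rightarrow> real) set" where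
  "Vhp a l \<T> = {v \<in> Vh a l \<T>. \<forall>x\<in>cube a l. v x > 0}"

text \<open>The grid is \<open>t\<^sup>n = n \<tau>\<close> for \<open>n \<le> N\<close>, with final time \<open>T = N \<tau>\<close>.\<close>

definition Pi1c :: "real \<Rightarrow> nat \<Rightarrow> (real^'d \<Rightarrow> 'b::real_vector) set \<Rightarrow> (real \<Rightarrow> real^'d \<Rightarrow> 'b) set" where
  "Pi1c \<tau> N X = {g. (\<forall>t\<in>{0..real N * \<tau>}. g t \<in> X) \<and>
     (\<forall>n<N. \<forall>r\<in>{0..1}. \<forall>x. g ((real n + r) * \<tau>) x
        = (1 - r) *\<^sub>R g (real n * \<tau>) x + r *\<^sub>R g (real (Suc n) * \<tau>) x)}"

text \<open>The value of a piecewise constant function at \<open>t\<^sup>n\<^sup>+\<^sup>1\<close> is its value on the interval ending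
  there; its value at time \<open>0\<close> is not constrained.\<close>

definition Pi0 :: "real \<Rightarrow> nat \<Rightarrow> (real^'d \<Rightarrow> 'b) set \<Rightarrow> (real \<Rightarrow> real^'d \<Rightarrow> 'b) set" where
  "Pi0 \<tau> N X = {g. (\<forall>t\<in>{0<..real N * \<tau>}. g t \<in> X) \<and>
     (\<forall>n<N. \<forall>t\<in>{real n * \<tau><..real (Suc n) * \<tau>}. g t = g (real (Suc n) * \<tau>))}"

definition mid :: "(real^'d \<Rightarrow> 'b::real_vector) \<Rightarrow> (real^'d \<Rightarrow> 'b) \<Rightarrow> real^'d \<Rightarrow> 'b" where
  "mid g0 g1 x = (1/2) *\<^sub>R (g1 x + g0 x)"

definition dtau :: "real \<Rightarrow> (real^'d \<Rightarrow> 'b::real_vector) \<Rightarrow> (real^'d \<Rightarrow> 'b) \<Rightarrow> real^'d \<Rightarrow> 'b" where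
  "dtau \<tau> g0 g1 x = (1/\<tau>) *\<^sub>R (g1 x - g0 x)"

text \<open>\<open>gam\<close> and \<open>visc\<close> are the parameters \<open>\<gamma>\<close> and \<open>\<eta>\<close>. Values at nonpositive \<open>\<theta>\<close> are irrelevant.\<close>

record 'd model =
  gam :: real
  visc :: "real \<Rightarrow> real \<Rightarrow> real"
  L11 :: "real \<Rightarrow> real^'d::finite \<Rightarrow> real \<Rightarrow> real^'d^'d"
  L12 :: "real \<Rightarrow> real^'d::finite \<Rightarrow> real \<Rightarrow> real^'d^'d"
  L22 :: "real \<Rightarrow> real^'d::finite \<Rightarrow> real \<Rightarrow> real^'d^'d"
  Psi :: "real \<Rightarrow> real \<Rightarrow> real"
  Psivex :: "real \<Rightarrow> real \<Rightarrow> real"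
  Psicav :: "real \<Rightarrow> real \<Rightarrow> real"

definition vpair :: "real^'d \<Rightarrow> real^'d \<Rightarrow> real^('d + 'd)" where
  "vpair a b = (\<chi> i. case i of Inl j \<Rightarrow> a $ j | Inr j \<Rightarrow> b $ j)"

definition block :: "real^'d^'d \<Rightarrow> real^'d^'d \<Rightarrow> real^'d^'d \<Rightarrow> real^'d^'d \<Rightarrow> real^('d + 'd)^('d + 'd)" where
  "block A B C D = (\<chi> i j. case i of
       Inl i' \<Rightarrow> (case j of Inl j' \<Rightarrow> A $ i' $ j' | Inr j' \<Rightarrow> B $ i' $ j')
     | Inr i' \<Rightarrow> (case j of Inl j' \<Rightarrow> C $ i' $ j' | Inr j' \<Rightarrow> D $ i' $ j'))"

definition Lmat :: "('d::finite) model \<Rightarrow> real \<Rightarrow> real^'d \<Rightarrow> real \<Rightarrow> real^('d + 'd)^('d + 'd)" where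
  "Lmat M p g t = block (L11 M p g t) (- L12 M p g t) (- L12 M p g t) (L22 M p g t)"

definition d\<phi> :: "(real \<Rightarrow> real \<Rightarrow> real) \<Rightarrow> real \<Rightarrow> real \<Rightarrow> real" where
  "d\<phi> F p t = deriv (\<lambda>q. F q t) p"

definition d\<theta> :: "(real \<Rightarrow> real \<Rightarrow> real) \<Rightarrow> real \<Rightarrow> real \<Rightarrow> real" where
  "d\<theta> F p t = deriv (\<lambda>r. F p r) t"

definition sigma :: "('d::finite) model \<Rightarrow> (real^'d \<Rightarrow> real) \<Rightarrow> (real^'d \<Rightarrow> real) \<Rightarrow> real^'d \<Rightarrow> real^'d^'d" where
  "sigma M \<phi> \<theta> x = (gam M / \<theta> x) *\<^sub>R outer (grad \<phi> x) (grad \<phi> x)"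

definition energy :: "('d::finite) model \<Rightarrow> (real^'d \<Rightarrow> real) \<Rightarrow> (real^'d \<Rightarrow> real) \<Rightarrow> real^'d \<Rightarrow> real" where
  "energy M \<phi> \<theta> x = d\<theta> (Psi M) (\<phi> x) (\<theta> x)"

definition Psitilde :: "('d::finite) model \<Rightarrow> (real^'d \<Rightarrow> real) \<Rightarrow> (real^'d \<Rightarrow> real) \<Rightarrow> real^'d \<Rightarrow> real" where
  "Psitilde M \<phi> \<theta> x = Psi M (\<phi> x) (\<theta> x) + gam M / 2 * (norm (grad \<phi> x))\<^sup>2"

definition entropy :: "('d::finite) model \<Rightarrow> (real^'d \<Rightarrow> real) \<Rightarrow> (real^'d \<Rightarrow> real) \<Rightarrow> real^'d \<Rightarrow> real" where
  "entropy M \<phi> \<theta> x = \<theta> x * energy M \<phi> \<theta> x - Psitilde M \<phi> \<theta> x"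

text \<open>Arguments ending in \<open>0\<close>, \<open>1\<close>, \<open>s\<close> are values at \<open>t\<^sup>n\<close>, at \<open>t\<^sup>n\<^sup>+\<^sup>1\<close> and at the starred time;
  \<open>uh\<close> is the midpoint velocity.\<close>

definition phase_eq where
  "phase_eq M \<Omega> \<tau> \<phi>0 \<phi>1 \<phi>s uh \<theta>1 \<theta>s \<mu>1 \<psi> \<longleftrightarrow>
     0 = ip \<Omega> (dtau \<tau> \<phi>0 \<phi>1) \<psi> - ip \<Omega> (\<lambda>x. \<phi>s x *\<^sub>R uh x) (grad \<psi>)
       + ip \<Omega> (\<lambda>x. L11 M (\<phi>s x) (grad \<phi>s x) (\<theta>s x) *v grad \<mu>1 x
                - L12 M (\<phi>s x) (grad \<phi>s x) (\<theta>s x) *v grad \<theta>1 x) (grad \<psi>)"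

definition potential_eq where
  "potential_eq M \<Omega> \<phi>0 \<phi>1 \<theta>1 \<mu>1 \<xi> \<longleftrightarrow>
     0 = ip \<Omega> \<mu>1 \<xi> - gam M * ip \<Omega> (grad \<phi>1) (grad \<xi>)
       - ip \<Omega> (\<lambda>x. d\<phi> (Psivex M) (\<phi>1 x) (\<theta>1 x) + d\<phi> (Psicav M) (\<phi>0 x) (\<theta>1 x)) \<xi>"

definition energy_eq where
  "energy_eq M \<Omega> \<tau> \<phi>0 \<phi>1 \<phi>s uh \<theta>0 \<theta>1 \<theta>s \<mu>1 \<mu>s w \<longleftrightarrow>
     0 = ip \<Omega> (dtau \<tau> (energy M \<phi>0 \<theta>0) (energy M \<phi>1 \<theta>1)) w
       - ip \<Omega> (\<lambda>x. visc M (\<phi>s x) (\<theta>s x) * (norm (Dsym uh x))\<^sup>2) w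
       + ip \<Omega> (\<lambda>x. L12 M (\<phi>s x) (grad \<phi>s x) (\<theta>s x) *v grad \<mu>1 x
                - L22 M (\<phi>s x) (grad \<phi>s x) (\<theta>s x) *v grad \<theta>1 x) (grad w)
       - ip \<Omega> (\<lambda>x. sigma M \<phi>s \<theta>s x *v uh x) (grad w)
       - ip \<Omega> (\<lambda>x. (\<phi>s x / \<theta>1 x) *\<^sub>R grad \<mu>1 x
                - sigma M \<phi>s \<theta>s x *v ((1 / \<theta>1 x) *\<^sub>R grad \<theta>1 x)) (\<lambda>x. w x *\<^sub>R uh x)
       - ip \<Omega> (\<lambda>x. (entropy M \<phi>s \<theta>s x + \<phi>s x * \<mu>s x) *\<^sub>R uh x)
           (\<lambda>x. (1 / (\<theta>s x)\<^sup>2) *\<^sub>R (\<theta>1 x *\<^sub>R grad w x - w x *\<^sub>R grad \<theta>1 x))"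

definition momentum_eq where
  "momentum_eq M \<Omega> \<tau> \<phi>s u0 u1 us uh \<theta>1 \<theta>s \<mu>1 \<mu>s \<pi>1 v \<longleftrightarrow>
     0 = ip \<Omega> (dtau \<tau> u0 u1) v + cskw \<Omega> us uh v
       + ip \<Omega> (\<lambda>x. visc M (\<phi>s x) (\<theta>s x) *\<^sub>R Dsym uh x) (Dsym v)
       - ip \<Omega> \<pi>1 (dvg v)
       + ip \<Omega> (\<lambda>x. (\<phi>s x / \<theta>1 x) *\<^sub>R grad \<mu>1 x
                - sigma M \<phi>s \<theta>s x *v ((1 / \<theta>1 x) *\<^sub>R grad \<theta>1 x)
                - ((entropy M \<phi>s \<theta>s x + \<phi>s x * \<mu>s x) / (\<theta>s x)\<^sup>2) *\<^sub>R grad \<theta>1 x) v"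

text \<open>\<open>ts n\<close> is the time at which the starred quantities of the step from \<open>t\<^sup>n\<close> to \<open>t\<^sup>n\<^sup>+\<^sup>1\<close> are
  evaluated. When the first step is explicit, \<open>\<mu> 0\<close> is the arbitrary given initial value.\<close>

definition scheme_solution ::
  "('d::finite) model \<Rightarrow> real^'d \<Rightarrow> real \<Rightarrow> (real^'d) set set \<Rightarrow> real \<Rightarrow> nat \<Rightarrow> (nat \<Rightarrow> real) \<Rightarrow>
   (real \<Rightarrow> real^'d \<Rightarrow> real) \<Rightarrow> (real \<Rightarrow> real^'d \<Rightarrow> real) \<Rightarrow> (real \<Rightarrow> real^'d \<Rightarrow> real^'d) \<Rightarrow>
   (real \<Rightarrow> real^'d \<Rightarrow> real) \<Rightarrow> (real \<Rightarrow> real^'d \<Rightarrow> real) \<Rightarrow> bool" where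
  "scheme_solution M a l \<T> \<tau> N ts \<phi> \<mu> u \<pi> \<theta> \<longleftrightarrow>
     \<phi> \<in> Pi1c \<tau> N (Vh a l \<T>) \<and> u \<in> Pi1c \<tau> N (Xh a l \<T>) \<and> \<theta> \<in> Pi1c \<tau> N (Vhp a l \<T>) \<and>
     \<mu> \<in> Pi0 \<tau> N (Vh a l \<T>) \<and> \<pi> \<in> Pi0 \<tau> N (Qh a l \<T>) \<and>
     (ts 0 = 0 \<longrightarrow> \<mu> 0 \<in> Vh a l \<T>) \<and>
     (\<forall>n<N. let \<Omega> = cube a l; t0 = real n * \<tau>; t1 = real (Suc n) * \<tau>; s = ts n;
                 uh = mid (u t0) (u t1)
       in (\<forall>\<psi>\<in>Vh a l \<T>. phase_eq M \<Omega> \<tau> (\<phi> t0) (\<phi> t1) (\<phi> s) uh (\<theta> t1) (\<theta> s) (\<mu> t1) \<psi>) \<and>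
          (\<forall>\<xi>\<in>Vh a l \<T>. potential_eq M \<Omega> (\<phi> t0) (\<phi> t1) (\<theta> t1) (\<mu> t1) \<xi>) \<and>
          (\<forall>w\<in>Vhp a l \<T>. energy_eq M \<Omega> \<tau> (\<phi> t0) (\<phi> t1) (\<phi> s) uh (\<theta> t0) (\<theta> t1) (\<theta> s) (\<mu> t1) (\<mu> s) w) \<and>
          (\<forall>v\<in>Xh a l \<T>. momentum_eq M \<Omega> \<tau> (\<phi> s) (u t0) (u t1) (u s) uh (\<theta> t1) (\<theta> s) (\<mu> t1) (\<mu> s) (\<pi> t1) v) \<and>
          (\<forall>q\<in>Qh a l \<T>. 0 = ip \<Omega> (dvg uh) q))"

definition dissipation where
  "dissipation M \<Omega> \<phi>s \<theta>s uh \<mu>1 \<theta>1 =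
     (norm0 \<Omega> (\<lambda>x. sqrt (visc M (\<phi>s x) (\<theta>s x) * \<theta>1 x) *\<^sub>R Dsym uh x))\<^sup>2
     + ip \<Omega> (\<lambda>x. vpair (grad \<mu>1 x) (grad \<theta>1 x))
         (\<lambda>x. Lmat M (\<phi>s x) (grad \<phi>s x) (\<theta>s x) *v vpair (grad \<mu>1 x) (grad \<theta>1 x))"

definition num_diss_density where
  "num_diss_density M \<phi>0 \<phi>1 \<theta>0 \<theta>1 \<xi>1 \<xi>2 \<xi>3 x =
     gam M / 2 * (norm (grad (\<lambda>y. \<phi>1 y - \<phi>0 y) x))\<^sup>2
     - (1/2) * d\<theta> (d\<theta> (Psi M)) (\<phi>0 x) (\<xi>3 x) * (\<theta>1 x - \<theta>0 x)\<^sup>2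
     + (1/2) * (d\<phi> (d\<phi> (Psivex M)) (\<xi>1 x) (\<theta>1 x) - d\<phi> (d\<phi> (Psicav M)) (\<xi>2 x) (\<theta>1 x))
         * (\<phi>1 x - \<phi>0 x)\<^sup>2"

end

(* Testing the phase equation with 1 gives mass conservation, and testing the momentum
   equation with the midpoint velocity and the energy equation with 1 gives energy conservation.

   For the entropy, Psi(phi1, theta1) - Psi(phi0, theta0) is expanded through the intermediate state
   (phi0, theta1): in theta around theta0, the convex part in phi around phi1 and the concave
   part in phi around phi0.  Together with |a|^2 - |b|^2 = 2 a.(a - b) - |a - b|^2 for the
   gradients, s1 - s0 becomes theta1 (e1 - e0) minus the right-hand side of the potential equation
   tested with phi1 - phi0, plus second-order remainders, which are the numerical dissipation.
   The first part is evaluated by testing the energy equation with theta1, the phase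
   equation with mu1 and the potential equation with phi1 - phi0; all convective terms then cancel.

   All integrands are, up to the null set of cell boundaries, continuous on each compact cell, hence
   integrable.  *)

theory Submission
  imports Defs
begin

section \<open>Piecewise continuous functions on a mesh\<close>

text \<open>The expansion points are dictated by the scheme: the potential equation contains the
  derivative of the convex part at \<open>\<phi>1\<close> and that of the concave part at
  \<open>\<phi>0\<close>. Expanding each part around exactly that point makes the first-order terms
  those of the scheme, while the tangent inequalities give both remainders the favourable sign. The
  weights in the energy equation serve two choices of \<open>w\<close> at once. For
  \<open>w = \<theta>1\<close> the factor \<open>1 / \<theta>1\<close> is cancelled and
  \<open>\<theta>1 \<nabla>w - w \<nabla>\<theta>1\<close> vanishes identically; for
  \<open>w = 1\<close> the same terms are the negatives of the ones in the momentum equation tested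
  with \<open>uh\<close>. Two obstacles shape the formal proof. Test functions have to be shown
  admissible, and \<open>fe_space\<close> contains a weak-derivative clause, so even the constant 1
  requires an integration by parts. Moreover the intermediate points come from a pointwise choice,
  so the dissipation is handled through exact Taylor remainders in which these points do not
  occur.\<close>

text \<open>The values on cell boundaries are left open because finite element functions need not be
  differentiable there; \<open>S\<close> bounds the range of the extensions to the closed cells, so that
  composition with functions that are continuous on \<open>S\<close> only is possible.\<close>

definition pwc :: "(real^'d) set set \<Rightarrow> 'b::topological_space set \<Rightarrow> (real^'d \<Rightarrow> 'b) \<Rightarrow> bool" where
  "pwc \<T> S f \<longleftrightarrow> (\<forall>K\<in>\<T>. \<exists>g. continuous_on K g \<and> g ` K \<subseteq> S \<and> (\<forall>x\<in>interior K. f x = g x))"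

lemma pwcD:
  assumes "pwc \<T> S f" "K \<in> \<T>"
  shows "\<exists>g. continuous_on K g \<and> g ` K \<subseteq> S \<and> (\<forall>x\<in>interior K. f x = g x)"
  using assms unfolding pwc_def by blast

lemma pwc_continuous:
  assumes "continuous_on UNIV f" "f ` \<Union>\<T> \<subseteq> S"
  shows "pwc \<T> S f"
  using assms unfolding pwc_def by (blast intro: continuous_on_subset)

lemma pwc_const: "pwc \<T> UNIV (\<lambda>x. c)"
  by (simp add: pwc_continuous)

lemma pwc_comp:
  assumes f: "pwc \<T> S f" and F: "continuous_on S F"
  shows "pwc \<T> UNIV (\<lambda>x. F (f x))"
  unfolding pwc_def
proof
  fix K assume "K \<in> \<T>"
  then obtain g where g: "continuous_on K g" "g ` K \<subseteq> S" "\<And>x. x \<in> interior K \<Longrightarrow> f x = g x"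
    using pwcD[OF f] by metis
  have "continuous_on K (\<lambda>x. F (g x))"
    using continuous_on_compose2[OF F g(1,2)] .
  then show "\<exists>h. continuous_on K h \<and> h ` K \<subseteq> UNIV \<and> (\<forall>x\<in>interior K. F (f x) = h x)"
    using g(3) by auto
qed

lemma pwc_Pair:
  assumes "pwc \<T> S f" and "pwc \<T> S' f'"
  shows "pwc \<T> (S \<times> S') (\<lambda>x. (f x, f' x))"
  unfolding pwc_def
proof
  fix K assume K: "K \<in> \<T>"
  obtain g where g: "continuous_on K g" "g ` K \<subseteq> S" "\<And>x. x \<in> interior K \<Longrightarrow> f x = g x"
    using pwcD[OF assms(1) K] by metis
  obtain g' where g': "continuous_on K g'" "g' ` K \<subseteq> S'" "\<And>x. x \<in> interior K \<Longrightarrow> f' x = g' x"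
    using pwcD[OF assms(2) K] by metis
  show "\<exists>h. continuous_on K h \<and> h ` K \<subseteq> S \<times> S' \<and> (\<forall>x\<in>interior K. (f x, f' x) = h x)"
    using g g' by (intro exI[of _ "\<lambda>x. (g x, g' x)"]) (auto intro: continuous_on_Pair)
qed

lemma pwc_comp2:
  assumes "pwc \<T> UNIV f" "pwc \<T> UNIV g" and "continuous_on UNIV (\<lambda>(x, y). F x y)"
  shows "pwc \<T> UNIV (\<lambda>x. F (f x) (g x))"
  using pwc_comp[of \<T> "UNIV \<times> UNIV" "\<lambda>x. (f x, g x)" "\<lambda>(x, y). F x y"] pwc_Pair[OF assms(1,2)] assms(3)
  by simp

lemma pwc_weaken: "pwc \<T> S f \<Longrightarrow> pwc \<T> UNIV f"
  unfolding pwc_def by blast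

lemma pwc_cong:
  assumes "\<And>x. x \<in> (\<Union>K\<in>\<T>. interior K) \<Longrightarrow> f x = g x" "pwc \<T> S g"
  shows "pwc \<T> S f"
  unfolding pwc_def
proof
  fix K assume K: "K \<in> \<T>"
  obtain h where "continuous_on K h" "h ` K \<subseteq> S" "\<And>x. x \<in> interior K \<Longrightarrow> g x = h x"
    using pwcD[OF assms(2) K] by metis
  then show "\<exists>h. continuous_on K h \<and> h ` K \<subseteq> S \<and> (\<forall>x\<in>interior K. f x = h x)"
    using assms(1) K by (intro exI[of _ h]) (metis UN_I)
qed

lemma pwc_vec:
  fixes f :: "real^'d \<Rightarrow> 'b::topological_space^'n"
  assumes "\<And>i. pwc \<T> UNIV (\<lambda>x. f x $ i)"
  shows "pwc \<T> UNIV f"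
  unfolding pwc_def
proof
  fix K assume K: "K \<in> \<T>"
  have "\<forall>i. \<exists>g. continuous_on K g \<and> (\<forall>x\<in>interior K. f x $ i = g x)"
    using assms K unfolding pwc_def by blast
  then obtain g where g: "\<And>i. continuous_on K (g i)" "\<And>i x. x \<in> interior K \<Longrightarrow> f x $ i = g i x"
    by metis
  show "\<exists>h. continuous_on K h \<and> h ` K \<subseteq> UNIV \<and> (\<forall>x\<in>interior K. f x = h x)"
    using g by (intro exI[of _ "\<lambda>x. \<chi> i. g i x"]) (auto intro!: continuous_on_vec_lambda simp: vec_eq_iff)
qed

lemma
  fixes f g :: "real^'d \<Rightarrow> 'b::real_normed_vector"
  assumes "pwc \<T> UNIV f" "pwc \<T> UNIV g"
  shows pwc_add: "pwc \<T> UNIV (\<lambda>x. f x + g x)" and pwc_diff: "pwc \<T> UNIV (\<lambda>x. f x - g x)"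
  by (intro pwc_comp2[OF assms]; auto simp: split_beta intro!: continuous_intros)+

lemma pwc_scaleR:
  fixes g :: "real^'d \<Rightarrow> 'b::real_normed_vector"
  assumes "pwc \<T> UNIV f" "pwc \<T> UNIV g"
  shows "pwc \<T> UNIV (\<lambda>x. f x *\<^sub>R g x)"
  by (intro pwc_comp2[OF assms]; auto simp: split_beta intro!: continuous_intros)

lemma pwc_mult:
  fixes f g :: "real^'d \<Rightarrow> real"
  assumes "pwc \<T> UNIV f" "pwc \<T> UNIV g"
  shows "pwc \<T> UNIV (\<lambda>x. f x * g x)"
  by (intro pwc_comp2[OF assms]; auto simp: split_beta intro!: continuous_intros)

lemma pwc_inner:
  fixes f g :: "real^'d \<Rightarrow> 'b::real_inner"
  assumes "pwc \<T> UNIV f" "pwc \<T> UNIV g"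
  shows "pwc \<T> UNIV (\<lambda>x. f x \<bullet> g x)"
  by (intro pwc_comp2[OF assms]; auto simp: split_beta intro!: continuous_intros)

lemma pwc_matrix_vector_mult:
  fixes A :: "real^'d \<Rightarrow> real^'n^'m"
  assumes "pwc \<T> UNIV A" "pwc \<T> UNIV v"
  shows "pwc \<T> UNIV (\<lambda>x. A x *v v x)"
  by (intro pwc_comp2[OF assms];
      auto simp: split_beta matrix_vector_mult_def intro!: continuous_intros continuous_on_vec_lambda)

lemma pwc_norm_power2:
  fixes f :: "real^'d \<Rightarrow> 'b::real_inner"
  assumes "pwc \<T> UNIV f"
  shows "pwc \<T> UNIV (\<lambda>x. (norm (f x))\<^sup>2)"
  using pwc_inner[OF assms assms] by (simp add: power2_norm_eq_inner)

text \<open>The range set \<open>{0<..}\<close> constrains the extension on the whole closed cell,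
  boundary included, so the inverse stays continuous there. Positivity in the interior alone would
  leave room for a blow-up at the boundary.\<close>

lemma pwc_inverse:
  assumes "pwc \<T> {0<..} f"
  shows "pwc \<T> UNIV (\<lambda>x. inverse (f x :: real))"
  by (intro pwc_comp[OF assms] continuous_intros) auto

section \<open>Integration over the meshed cube\<close>

locale mesh =
  fixes a :: "real^'d" and l :: real and \<T> :: "(real^'d) set set"
  assumes mesh: "periodic_mesh a l \<T>"
begin

abbreviation "\<Omega> \<equiv> cube a l"
abbreviation "\<Omega>o \<equiv> (\<Union>K\<in>\<T>. interior K)"

lemma finite_mesh: "finite \<T>" and Union_mesh: "\<Union>\<T> = \<Omega>"
  using mesh by (auto simp: periodic_mesh_def)

lemma compact_cell: "K \<in> \<T> \<Longrightarrow> compact K" and convex_cell: "K \<in> \<T> \<Longrightarrow> convex K"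
  using mesh compact_simplex convex_simplex unfolding periodic_mesh_def by blast+

lemma cell_sets: "K \<in> \<T> \<Longrightarrow> K \<in> sets lebesgue"
  using compact_cell by (simp add: lmeasurable_compact fmeasurableD)

lemma cell_interior_subset: "\<Omega>o \<subseteq> \<Omega>"
  using interior_subset Union_mesh by blast

definition skeleton :: "(real^'d) set" where "skeleton = (\<Union>K\<in>\<T>. frontier K)"

lemma negligible_skeleton: "negligible skeleton"
  unfolding skeleton_def using finite_mesh convex_cell negligible_convex_frontier by blast

lemma off_skeleton: "\<Omega> - skeleton \<subseteq> \<Omega>o"
proof
  fix x assume x: "x \<in> \<Omega> - skeleton"
  then obtain K where K: "K \<in> \<T>" "x \<in> K"
    using Union_mesh by blast
  with x have "x \<notin> frontier K"
    by (auto simp: skeleton_def)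
  then show "x \<in> \<Omega>o"
    using K closure_subset by (auto simp: frontier_def)
qed

lemma pwc_integrable:
  fixes f :: "real^'d \<Rightarrow> real"
  assumes "pwc \<T> S f"
  shows "set_integrable lebesgue \<Omega> f"
proof -
  have "set_integrable lebesgue K f" if K: "K \<in> \<T>" for K
  proof -
    obtain g where g: "continuous_on K g" "\<And>x. x \<in> interior K \<Longrightarrow> f x = g x"
      using pwcD[OF assms K] by metis
    have "g absolutely_integrable_on K"
      using absolutely_integrable_continuous g(1) compact_cell[OF K] convex_cell[OF K]
        borel_integrable_compact[OF compact_cell[OF K] g(1)]
      by (simp add: set_integrable_def integrable_completion borel_measurable_continuous_on_indicator compact_imp_closed borel_closed)
    then show ?thesis
      by (rule absolutely_integrable_spike[where S = "frontier K"])
        (use g(2) convex_cell[OF K] closure_subset[of K] in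
          \<open>auto simp: negligible_convex_frontier, auto simp: frontier_def\<close>)
  qed
  \<comment> \<open>Cells may share faces. This is harmless because only integrability over the
    union is claimed, not additivity of the integral.\<close>
  then have "set_integrable lebesgue (\<Union>K\<in>\<T>. K) f"
    by (intro set_integrable_UN finite_mesh cell_sets) auto
  then show ?thesis
    by (simp add: Union_mesh)
qed

lemma pwc_integral_cong:
  fixes f g :: "real^'d \<Rightarrow> real"
  assumes "pwc \<T> S f" and "\<And>x. x \<in> \<Omega>o \<Longrightarrow> f x = g x"
  shows "(LINT x:\<Omega>|lebesgue. f x) = (LINT x:\<Omega>|lebesgue. g x)"
proof -
  have "pwc \<T> S g"
    by (rule pwc_cong[OF _ assms(1)]) (simp add: assms(2))
  then have "(LINT x:\<Omega>|lebesgue. f x) = integral \<Omega> f" "(LINT x:\<Omega>|lebesgue. g x) = integral \<Omega> g"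
    using assms(1) pwc_integrable by (auto intro: set_lebesgue_integral_eq_integral(2))
  moreover have "integral \<Omega> f = integral \<Omega> g"
    by (rule integral_spike[OF negligible_skeleton]) (use off_skeleton assms in force)
  ultimately show ?thesis
    by simp
qed

end

section \<open>Gradients of finite element functions\<close>

text \<open>The gradient is carried along as an explicit continuous field, so that its existence for
  polynomials follows by closure under sums and products, without any formula for it.\<close>

definition has_cgrad :: "(real^'d \<Rightarrow> real) \<Rightarrow> (real^'d \<Rightarrow> real^'d) \<Rightarrow> bool" where
  "has_cgrad p G \<longleftrightarrow> continuous_on UNIV G \<and> (\<forall>x. (p has_derivative (\<lambda>h. G x \<bullet> h)) (at x))"

lemma has_cgrad_continuous:
  assumes "has_cgrad p G" shows "continuous_on UNIV p"
  using assms unfolding has_cgrad_def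
  by (intro has_derivative_continuous_on[of UNIV p "\<lambda>x h. G x \<bullet> h"]) auto

lemma has_cgrad_const: "has_cgrad (\<lambda>x. c) (\<lambda>x. 0)"
  by (auto simp: has_cgrad_def)

lemma has_cgrad_nth: "has_cgrad (\<lambda>x. x $ i) (\<lambda>x. axis i 1)"
  by (auto simp: has_cgrad_def inner_axis' bounded_linear_vec_nth bounded_linear_imp_has_derivative)

lemma has_cgrad_add:
  assumes "has_cgrad p G" "has_cgrad q H"
  shows "has_cgrad (\<lambda>x. p x + q x) (\<lambda>x. G x + H x)"
  using assms unfolding has_cgrad_def
  by (auto intro!: continuous_intros derivative_eq_intros simp: inner_add_left)

lemma has_cgrad_mult:
  assumes "has_cgrad p G" "has_cgrad q H"
  shows "has_cgrad (\<lambda>x. p x * q x) (\<lambda>x. p x *\<^sub>R H x + q x *\<^sub>R G x)"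
  using assms has_cgrad_continuous[OF assms(1)] has_cgrad_continuous[OF assms(2)] unfolding has_cgrad_def
  by (auto intro!: continuous_intros derivative_eq_intros simp: inner_add_left)

lemma has_cgrad_power:
  assumes "has_cgrad p G"
  shows "\<exists>H. has_cgrad (\<lambda>x. p x ^ n) H"
proof (induction n)
  case 0
  then show ?case using has_cgrad_const by auto
next
  case (Suc n)
  then show ?case using has_cgrad_mult[OF assms] by auto
qed

lemma has_cgrad_sum:
  assumes "\<And>i. i \<in> I \<Longrightarrow> \<exists>H. has_cgrad (p i) H"
  shows "\<exists>H. has_cgrad (\<lambda>x. \<Sum>i\<in>I. p i x) H"
  using assms
proof (induction I rule: infinite_finite_induct)
  case (insert i I)
  obtain G H where "has_cgrad (p i) G" "has_cgrad (\<lambda>x. \<Sum>i\<in>I. p i x) H"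
    using insert by blast
  from has_cgrad_add[OF this] show ?case using insert by auto
qed (use has_cgrad_const in auto)

lemma has_cgrad_prod:
  assumes "\<And>i. i \<in> I \<Longrightarrow> \<exists>H. has_cgrad (p i) H"
  shows "\<exists>H. has_cgrad (\<lambda>x. \<Prod>i\<in>I. p i x) H"
  using assms
proof (induction I rule: infinite_finite_induct)
  case (insert i I)
  obtain G H where "has_cgrad (p i) G" "has_cgrad (\<lambda>x. \<Prod>i\<in>I. p i x) H"
    using insert by blast
  from has_cgrad_mult[OF this] show ?case using insert by auto
qed (use has_cgrad_const in auto)

lemma poly_deg_has_cgrad:
  fixes p :: "real^'d::finite \<Rightarrow> real"
  assumes "p \<in> poly_deg k"
  obtains G where "has_cgrad p G"
proof -
  obtain c :: "('d \<Rightarrow> nat) \<Rightarrow> real" where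
    "p = (\<lambda>x. \<Sum>\<alpha> | (\<Sum>i\<in>UNIV. \<alpha> i) \<le> k. c \<alpha> * (\<Prod>i\<in>UNIV. (x $ i) ^ \<alpha> i))"
    using assms by (auto simp: poly_deg_def)
  moreover have "\<exists>H. has_cgrad (\<lambda>x. c \<alpha> * (\<Prod>i\<in>UNIV. (x $ i) ^ \<alpha> i)) H" for \<alpha>
    using has_cgrad_mult[OF has_cgrad_const[of "c \<alpha>"]]
      has_cgrad_prod[of UNIV "\<lambda>i x. (x $ i) ^ \<alpha> i"] has_cgrad_power[OF has_cgrad_nth]
    by blast
  ultimately have "\<exists>H. has_cgrad p H"
    by (simp add: has_cgrad_sum)
  then show thesis
    using that by blast
qed

text \<open>Every component of such an index is at most \<open>k\<close>. Finiteness keeps the sum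
  in \<open>poly_deg\<close> from being the default value 0 of sums over infinite sets, and it
  allows a sum with a single nonzero coefficient to be evaluated.\<close>

lemma finite_multiindices: "finite {\<alpha> :: 'd::finite \<Rightarrow> nat. (\<Sum>i\<in>UNIV. \<alpha> i) \<le> k}"
proof (rule finite_subset)
  show "{\<alpha> :: 'd \<Rightarrow> nat. (\<Sum>i\<in>UNIV. \<alpha> i) \<le> k} \<subseteq> (\<Pi>\<^sub>E i\<in>UNIV. {..k})"
  proof
    fix \<alpha> :: "'d \<Rightarrow> nat" assume "\<alpha> \<in> {\<alpha>. (\<Sum>i\<in>UNIV. \<alpha> i) \<le> k}"
    moreover have "\<alpha> i \<le> (\<Sum>i\<in>UNIV. \<alpha> i)" for i
      by (rule member_le_sum) auto
    ultimately show "\<alpha> \<in> (\<Pi>\<^sub>E i\<in>UNIV. {..k})"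
      by (auto intro: le_trans)
  qed
qed (intro finite_PiE; simp)

lemma one_in_poly_deg: "(\<lambda>x :: real^'d::finite. 1) \<in> poly_deg k"
proof -
  let ?S = "{\<alpha> :: 'd \<Rightarrow> nat. (\<Sum>i\<in>UNIV. \<alpha> i) \<le> k}"
  have "(\<Sum>\<alpha>\<in>?S. (if \<alpha> = (\<lambda>_. 0) then 1 else 0) * (\<Prod>i\<in>UNIV. (x $ i) ^ \<alpha> i)) = 1" for x :: "real^'d"
  proof -
    have "(\<Sum>\<alpha>\<in>?S. (if \<alpha> = (\<lambda>_. 0) then 1 else 0) * (\<Prod>i\<in>UNIV. (x $ i) ^ \<alpha> i))
        = (\<Sum>\<alpha>\<in>?S. if \<alpha> = (\<lambda>_. 0) then 1 else 0)"
      by (intro sum.cong refl) auto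
    then show ?thesis
      by (simp add: finite_multiindices)
  qed
  then show ?thesis
    unfolding poly_deg_def by (auto intro!: exI[of _ "\<lambda>\<alpha>. if \<alpha> = (\<lambda>_. 0) then 1 else 0"])
qed

lemma poly_deg_diff:
  fixes p q :: "real^'d::finite \<Rightarrow> real"
  assumes "p \<in> poly_deg k" "q \<in> poly_deg k"
  shows "(\<lambda>x. p x - q x) \<in> poly_deg k"
proof -
  obtain c :: "('d \<Rightarrow> nat) \<Rightarrow> real" where
    c: "\<forall>x. p x = (\<Sum>\<alpha> | (\<Sum>i\<in>UNIV. \<alpha> i) \<le> k. c \<alpha> * (\<Prod>i\<in>UNIV. (x $ i) ^ \<alpha> i))"
    using assms(1) unfolding poly_deg_def by blast
  obtain d :: "('d \<Rightarrow> nat) \<Rightarrow> real" where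
    d: "\<forall>x. q x = (\<Sum>\<alpha> | (\<Sum>i\<in>UNIV. \<alpha> i) \<le> k. d \<alpha> * (\<Prod>i\<in>UNIV. (x $ i) ^ \<alpha> i))"
    using assms(2) unfolding poly_deg_def by blast
  show ?thesis
    unfolding poly_deg_def mem_Collect_eq
    by (rule exI[of _ "\<lambda>\<alpha>. c \<alpha> - d \<alpha>"]) (simp add: c d left_diff_distrib sum_subtractf)
qed

section \<open>Classical derivatives of finite element functions inside a cell\<close>

lemma grad_eqI:
  assumes "(v has_derivative (\<lambda>h. G \<bullet> h)) (at x)"
  shows "grad v x = G"
  by (simp add: grad_def vec_eq_iff inner_axis flip: frechet_derivative_at[OF assms])

lemma jacobian_eqI:
  assumes "\<And>i. ((\<lambda>y. u y $ i) has_derivative (\<lambda>h. G i \<bullet> h)) (at x)"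
  shows "jacobian u (at x) = (\<chi> i. G i)"
proof -
  have "(u has_derivative (\<lambda>h. \<chi> i. G i \<bullet> h)) (at x)"
    using assms by (subst has_derivative_componentwise_within) (auto simp: Basis_vec_def inner_axis)
  note frechet_derivative_at[OF this, symmetric]
  then show ?thesis
    by (simp add: jacobian_def matrix_def vec_eq_iff inner_axis)
qed

text \<open>On the open interior \<open>v\<close> coincides with a polynomial, hence so do the
  derivatives. Taking for \<open>G\<close> the gradient of that polynomial, which is defined
  everywhere, provides the continuous extension to the closed cell.\<close>

lemma fe_cell_gradient:
  assumes "v \<in> fe_space k a l \<T>" "K \<in> \<T>"
  obtains G where "continuous_on UNIV G"
    "\<And>x. x \<in> interior K \<Longrightarrow> (v has_derivative (\<lambda>h. G x \<bullet> h)) (at x)"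
proof -
  obtain p where p: "p \<in> poly_deg k" "\<And>x. x \<in> K \<Longrightarrow> v x = p x"
    using assms by (auto simp: fe_space_def)
  obtain G where G: "has_cgrad p G"
    using p(1) by (rule poly_deg_has_cgrad)
  show thesis
  proof
    show "continuous_on UNIV G" using G by (simp add: has_cgrad_def)
    fix x assume x: "x \<in> interior K"
    show "(v has_derivative (\<lambda>h. G x \<bullet> h)) (at x)"
    proof (rule has_derivative_transform_within_open)
      show "(p has_derivative (\<lambda>h. G x \<bullet> h)) (at x)" using G by (simp add: has_cgrad_def)
    qed (use x p(2) interior_subset[of K] in auto)
  qed
qed

lemma pwc_fe: "v \<in> fe_space k a l \<T> \<Longrightarrow> pwc \<T> UNIV v"
  by (rule pwc_continuous) (auto simp: fe_space_def)

lemma pwc_grad: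
  assumes "v \<in> fe_space k a l \<T>"
  shows "pwc \<T> UNIV (grad v)"
  unfolding pwc_def
proof
  fix K assume "K \<in> \<T>"
  then obtain G where "continuous_on UNIV G" "\<And>x. x \<in> interior K \<Longrightarrow> grad v x = G x"
    using fe_cell_gradient[OF assms] grad_eqI by metis
  then show "\<exists>g. continuous_on K g \<and> g ` K \<subseteq> UNIV \<and> (\<forall>x\<in>interior K. grad v x = g x)"
    using continuous_on_subset by blast
qed

text \<open>Restricted to cell interiors because \<open>grad\<close> is unspecified where a function
  is not differentiable, and linearity cannot be expected there.\<close>

lemma grad_diff:
  assumes "v \<in> fe_space k a l \<T>" "w \<in> fe_space m a l \<T>" "x \<in> (\<Union>K\<in>\<T>. interior K)"
  shows "grad (\<lambda>y. v y - w y) x = grad v x - grad w x"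
proof -
  obtain K where K: "K \<in> \<T>" "x \<in> interior K"
    using assms(3) by blast
  obtain G where G: "(v has_derivative (\<lambda>h. G x \<bullet> h)) (at x)"
    using fe_cell_gradient[OF assms(1) K(1)] K(2) by metis
  obtain H where H: "(w has_derivative (\<lambda>h. H x \<bullet> h)) (at x)"
    using fe_cell_gradient[OF assms(2) K(1)] K(2) by metis
  have "((\<lambda>y. v y - w y) has_derivative (\<lambda>h. (G x - H x) \<bullet> h)) (at x)"
    using has_derivative_diff[OF G H] by (simp add: inner_diff_left)
  then show ?thesis
    using grad_eqI G H by metis
qed

lemma pwc_jacobian:
  assumes "u \<in> Xh a l \<T>"
  shows "pwc \<T> UNIV (\<lambda>x. jacobian u (at x))"
  unfolding pwc_def
proof
  fix K assume K: "K \<in> \<T>"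
  have "\<forall>i. \<exists>G. continuous_on UNIV G \<and>
      (\<forall>x\<in>interior K. ((\<lambda>y. u y $ i) has_derivative (\<lambda>h. G x \<bullet> h)) (at x))"
    using fe_cell_gradient[OF _ K] assms unfolding Xh_def by (metis (mono_tags, lifting) mem_Collect_eq)
  then obtain G where G: "\<And>i. continuous_on UNIV (G i)"
    "\<And>i x. x \<in> interior K \<Longrightarrow> ((\<lambda>y. u y $ i) has_derivative (\<lambda>h. G i x \<bullet> h)) (at x)"
    by metis
  have "continuous_on K (\<lambda>x. \<chi> i. G i x)"
    using G(1) by (auto intro!: continuous_on_vec_lambda intro: continuous_on_subset)
  moreover have "jacobian u (at x) = (\<chi> i. G i x)" if "x \<in> interior K" for x
    by (rule jacobian_eqI) (rule G(2)[OF that])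
  ultimately show "\<exists>g. continuous_on K g \<and> g ` K \<subseteq> UNIV \<and> (\<forall>x\<in>interior K. jacobian u (at x) = g x)"
    by (intro exI[of _ "\<lambda>x. \<chi> i. G i x"]) auto
qed

lemma pwc_Dsym:
  assumes "u \<in> Xh a l \<T>"
  shows "pwc \<T> UNIV (Dsym u)"
proof -
  have "pwc \<T> UNIV (\<lambda>x. (1/2) *\<^sub>R (jacobian u (at x) + transpose (jacobian u (at x))))"
    by (rule pwc_comp[OF pwc_jacobian[OF assms]])
      (auto simp: transpose_def intro!: continuous_intros continuous_on_vec_lambda)
  then show ?thesis
    by (simp add: Dsym_def[abs_def])
qed

lemma pwc_Xh: "u \<in> Xh a l \<T> \<Longrightarrow> pwc \<T> UNIV u"
  by (rule pwc_vec, rule pwc_fe) (auto simp: Xh_def)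

section \<open>Second-order expansions\<close>

lemma C1_on_continuous:
  assumes "C1_on S f"
  shows "continuous_on S f"
proof -
  obtain f' where "\<And>x. x \<in> S \<Longrightarrow> (f has_derivative blinfun_apply (f' x)) (at x)"
    using assms unfolding C1_on_def by blast
  then show ?thesis
    by (intro has_derivative_continuous_on) (rule has_derivative_at_withinI)
qed

lemma has_derivative_Pair_left:
  fixes G :: "real \<times> real \<Rightarrow> real"
  assumes "(G has_derivative G') (at (p, r))"
  shows "((\<lambda>q. G (q, r)) has_real_derivative G' (1, 0)) (at p)"
proof -
  have "((\<lambda>q. G (q, r)) has_derivative (\<lambda>h. G' (h, 0))) (at p)"
    using has_derivative_compose[OF has_derivative_Pair[OF has_derivative_ident has_derivative_const] assms] .
  moreover have "(\<lambda>h. G' (h, 0)) = (*) (G' (1, 0))"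
  proof
    show "G' (h, 0) = G' (1, 0) * h" for h
      using linear_cmul[OF has_derivative_linear[OF assms], of h "(1, 0)"] by simp
  qed
  ultimately show ?thesis
    by (simp add: has_field_derivative_def)
qed

lemma has_derivative_Pair_right:
  fixes G :: "real \<times> real \<Rightarrow> real"
  assumes "(G has_derivative G') (at (p, r))"
  shows "((\<lambda>s. G (p, s)) has_real_derivative G' (0, 1)) (at r)"
proof -
  have "((\<lambda>s. G (p, s)) has_derivative (\<lambda>h. G' (0, h))) (at r)"
    using has_derivative_compose[OF has_derivative_Pair[OF has_derivative_const has_derivative_ident] assms] .
  moreover have "(\<lambda>h. G' (0, h)) = (*) (G' (0, 1))"
  proof
    show "G' (0, h) = G' (0, 1) * h" for h
      using linear_cmul[OF has_derivative_linear[OF assms], of h "(0, 1)"] by simp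
  qed
  ultimately show ?thesis
    by (simp add: has_field_derivative_def)
qed

text \<open>The total derivative \<open>f'\<close> evaluated at the unit vectors
  \<open>(1, 0)\<close> and \<open>(0, 1)\<close> yields the partial derivatives. Evaluation at a
  fixed vector is bounded linear, so continuity and differentiability of \<open>f'\<close> carry
  over to them.\<close>

lemma C2_on_partials:
  assumes "C2_on (UNIV \<times> {0<..}) (\<lambda>(p, r). F p r)"
  shows "r > 0 \<Longrightarrow> ((\<lambda>q. F q r) has_real_derivative d\<phi> F p r) (at p)"
    and "r > 0 \<Longrightarrow> ((\<lambda>s. F p s) has_real_derivative d\<theta> F p r) (at r)"
    and "continuous_on (UNIV \<times> {0<..}) (\<lambda>(p, r). F p r)"
    and "continuous_on (UNIV \<times> {0<..}) (\<lambda>(p, r). d\<phi> F p r)"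
    and "continuous_on (UNIV \<times> {0<..}) (\<lambda>(p, r). d\<theta> F p r)"
    and "r > 0 \<Longrightarrow> ((\<lambda>q. d\<phi> F q r) has_real_derivative d\<phi> (d\<phi> F) p r) (at p)"
    and "r > 0 \<Longrightarrow> ((\<lambda>s. d\<theta> F p s) has_real_derivative d\<theta> (d\<theta> F) p r) (at r)"
proof -
  let ?S = "UNIV \<times> {0<..} :: (real \<times> real) set"
  obtain f' :: "real \<times> real \<Rightarrow> (real \<times> real) \<Rightarrow>\<^sub>L real" where
    f': "\<And>x. x \<in> ?S \<Longrightarrow> ((\<lambda>(p, r). F p r) has_derivative f' x) (at x)" and C1: "C1_on ?S f'"
    using assms unfolding C2_on_def by blast
  obtain f'' where f'': "\<And>x. x \<in> ?S \<Longrightarrow> (f' has_derivative blinfun_apply (f'' x)) (at x)"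
    using C1 unfolding C1_on_def by blast
  have cf': "continuous_on ?S f'"
    using C1 by (rule C1_on_continuous)
  have D1: "((\<lambda>q. F q r) has_real_derivative f' (p, r) (1, 0)) (at p)" if "r > 0" for p r
    using has_derivative_Pair_left[OF f'[of "(p, r)"]] that by simp
  have D2: "((\<lambda>s. F p s) has_real_derivative f' (p, r) (0, 1)) (at r)" if "r > 0" for p r
    using has_derivative_Pair_right[OF f'[of "(p, r)"]] that by simp
  have e1: "d\<phi> F p r = f' (p, r) (1, 0)" if "r > 0" for p r
    unfolding d\<phi>_def using D1[OF that] by (rule DERIV_imp_deriv)
  have e2: "d\<theta> F p r = f' (p, r) (0, 1)" if "r > 0" for p r
    unfolding d\<theta>_def using D2[OF that] by (rule DERIV_imp_deriv)
  show "((\<lambda>q. F q r) has_real_derivative d\<phi> F p r) (at p)" if "r > 0"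
    using D1 e1 that by simp
  show "((\<lambda>s. F p s) has_real_derivative d\<theta> F p r) (at r)" if "r > 0"
    using D2 e2 that by simp
  show "continuous_on ?S (\<lambda>(p, r). F p r)"
    by (rule has_derivative_continuous_on) (rule has_derivative_at_withinI, rule f')
  show "continuous_on ?S (\<lambda>(p, r). d\<phi> F p r)"
    by (rule continuous_on_eq[of _ "\<lambda>x. f' x (1, 0)"]) (auto simp: e1 intro!: continuous_intros cf')
  show "continuous_on ?S (\<lambda>(p, r). d\<theta> F p r)"
    by (rule continuous_on_eq[of _ "\<lambda>x. f' x (0, 1)"]) (auto simp: e2 intro!: continuous_intros cf')
  have app: "((\<lambda>x. f' x v) has_derivative (\<lambda>h. f'' x h v)) (at x)" if "x \<in> ?S" for x v
    using bounded_linear.has_derivative[OF blinfun.bounded_linear_left f''[OF that]] .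
  show "((\<lambda>q. d\<phi> F q r) has_real_derivative d\<phi> (d\<phi> F) p r) (at p)" if "r > 0"
  proof -
    have "((\<lambda>q. d\<phi> F q r) has_real_derivative f'' (p, r) (1, 0) (1, 0)) (at p)"
      using has_derivative_Pair_left[OF app[of "(p, r)" "(1, 0)"]] that e1 by simp
    then show ?thesis
      unfolding d\<phi>_def[of "d\<phi> F"] by (simp add: DERIV_imp_deriv)
  qed
  show "((\<lambda>s. d\<theta> F p s) has_real_derivative d\<theta> (d\<theta> F) p r) (at r)" if "r > 0"
  proof -
    have "((\<lambda>s. f' (p, s) (0, 1)) has_real_derivative f'' (p, r) (0, 1) (0, 1)) (at r)"
      using has_derivative_Pair_right[OF app[of "(p, r)" "(0, 1)"]] that by simp
    \<comment> \<open>The identification \<open>e2\<close> is available for positive second argument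
      only. Moving in this direction changes that argument, so the equality is used locally, on the
      open half-line around \<open>r\<close>.\<close>
    then have "((\<lambda>s. d\<theta> F p s) has_real_derivative f'' (p, r) (0, 1) (0, 1)) (at r)"
      by (rule has_field_derivative_transform_within_open[of _ _ _ "{0<..}"]) (use that e2 in auto)
    then show ?thesis
      unfolding d\<theta>_def[of "d\<theta> F"] by (simp add: DERIV_imp_deriv)
  qed
qed

text \<open>Lagrange form of the remainder. The degenerate case \<open>x = c\<close>, which the
  library theorem \<open>Taylor\<close> excludes, has to be included, since consecutive iterates may
  coincide at some points.\<close>

lemma second_order_Taylor:
  fixes f f' f'' :: "real \<Rightarrow> real"
  assumes "\<And>z. z \<in> closed_segment c x \<Longrightarrow> (f has_real_derivative f' z) (at z)"
    and "\<And>z. z \<in> closed_segment c x \<Longrightarrow> (f' has_real_derivative f'' z) (at z)"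
  shows "\<exists>z\<in>closed_segment c x. f x = f c + f' c * (x - c) + (1/2) * f'' z * (x - c)\<^sup>2"
proof (cases "x = c")
  case False
  define diff where "diff = (\<lambda>m::nat. if m = 0 then f else if m = 1 then f' else f'')"
  \<comment> \<open>The order of \<open>c\<close> and \<open>x\<close> is unknown, so the interval
    is spanned by their minimum and maximum.\<close>
  have "\<exists>t. (if x < c then x < t \<and> t < c else c < t \<and> t < x) \<and>
    f x = (\<Sum>m<2. (diff m c / fact m) * (x - c)^m) + (diff 2 t / fact 2) * (x - c)^2"
    by (rule Taylor[of 2 diff f "min c x" "max c x"])
      (use assms False in \<open>auto simp: diff_def less_2_cases_iff closed_segment_eq_real_ivl
          min_def max_def split: if_splits\<close>)
  then obtain t where t: "if x < c then x < t \<and> t < c else c < t \<and> t < x"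
    and "f x = (\<Sum>m<2. (diff m c / fact m) * (x - c)^m) + (diff 2 t / fact 2) * (x - c)^2"
    by blast
  then have "f x = f c + f' c * (x - c) + (1/2) * f'' t * (x - c)\<^sup>2"
    by (simp add: diff_def numeral_2_eq_2)
  moreover have "t \<in> closed_segment c x"
    using t by (auto simp: closed_segment_eq_real_ivl split: if_splits)
  ultimately show ?thesis
    by blast
qed auto

lemma strictly_convex_on_imp_convex_on:
  assumes "strictly_convex_on S f"
  shows "convex_on S f"
proof (rule convex_onI)
  fix r x y :: real assume *: "0 < r" "r < 1" "x \<in> S" "y \<in> S"
  show "f ((1 - r) *\<^sub>R x + r *\<^sub>R y) \<le> (1 - r) * f x + r * f y"
  proof (cases "x = y")
    case True
    then show ?thesis by (simp add: algebra_simps)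
  next
    case False
    with * assms have "f ((1 - r) * x + r * y) < (1 - r) * f x + r * f y"
      unfolding strictly_convex_on_def by blast
    then show ?thesis by simp
  qed
qed (use assms in \<open>simp add: strictly_convex_on_def\<close>)

section \<open>Constants and differences in the finite element spaces\<close>

lemma C1_on_UNIV_gradient:
  fixes \<zeta> :: "real^'d \<Rightarrow> real"
  assumes "C1_on UNIV \<zeta>"
  shows "(\<zeta> has_derivative (\<lambda>h. grad \<zeta> x \<bullet> h)) (at x)" and "continuous_on UNIV (grad \<zeta>)"
proof -
  obtain f' where f': "\<And>x. (\<zeta> has_derivative blinfun_apply (f' x)) (at x)" and cf': "continuous_on UNIV f'"
    using assms unfolding C1_on_def by blast
  have g: "grad \<zeta> x = (\<chi> i. f' x (axis i 1))" for x
    using f'[of x] by (simp add: grad_def flip: frechet_derivative_at)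
  have "f' x h = grad \<zeta> x \<bullet> h" for x h
  proof -
    have "f' x (\<Sum>i\<in>UNIV. h $ i *\<^sub>R axis i 1) = (\<Sum>i\<in>UNIV. h $ i * f' x (axis i 1))"
      by (simp add: blinfun.sum_right blinfun.scaleR_right)
    moreover have "(\<Sum>i\<in>UNIV. h $ i *\<^sub>R axis i 1) = h"
      by (simp add: vec_eq_iff axis_def if_distrib cong: if_cong)
    ultimately show ?thesis
      by (simp add: g inner_vec_def mult.commute)
  qed
  then have "blinfun_apply (f' x) = (\<lambda>h. grad \<zeta> x \<bullet> h)" for x
    by blast
  then show "(\<zeta> has_derivative (\<lambda>h. grad \<zeta> x \<bullet> h)) (at x)" for x
    using f' by metis
  show "continuous_on UNIV (grad \<zeta>)"
    unfolding g[abs_def] using cf' by (intro continuous_on_vec_lambda continuous_intros)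
qed

text \<open>The complement of the closed support is open and \<zeta> vanishes on it, so \<zeta> is
  locally constant there.\<close>

lemma grad_outside_support:
  fixes \<zeta> :: "real^'d \<Rightarrow> real"
  assumes "x \<notin> closure {x. \<zeta> x \<noteq> 0}"
  shows "grad \<zeta> x = 0"
proof (rule grad_eqI)
  show "(\<zeta> has_derivative (\<lambda>h. 0 \<bullet> h)) (at x)"
  proof (rule has_derivative_transform_within_open)
    show "((\<lambda>x. 0) has_derivative (\<lambda>h. 0 \<bullet> h)) (at x)" by simp
    show "open (- closure {x. \<zeta> x \<noteq> 0})" by auto
  qed (use assms closure_subset[of "{x. \<zeta> x \<noteq> 0}"] in auto)
qed

section \<open>Derivatives of compactly supported functions integrate to zero\<close>

lemma integral_shift:
  fixes f :: "real^'d \<Rightarrow> real"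
  assumes "f \<in> borel_measurable borel"
  shows "(LINT x|lborel. f (c + x)) = (LINT x|lborel. f x)"
proof -
  have "(LINT x|lborel. f x) = (LINT x|distr lborel borel ((+) c). f x)"
    by (simp add: lborel_distr_plus)
  also have "\<dots> = (LINT x|lborel. f (c + x))"
    by (rule integral_distr) (use assms in auto)
  finally show ?thesis by simp
qed

text \<open>The difference quotients of \<open>\<zeta>\<close> integrate to zero by translation invariance.\<close>

lemma integral_partial_eq_0:
  fixes \<zeta> :: "real^'d \<Rightarrow> real"
  assumes C1: "C1_on UNIV \<zeta>" and supp: "compact (closure {x. \<zeta> x \<noteq> 0})"
  shows "(LINT x|lborel. grad \<zeta> x $ i) = 0"
proof -
  let ?S = "closure {x. \<zeta> x \<noteq> 0}"
  note D = C1_on_UNIV_gradient(1)[OF C1] and cg = C1_on_UNIV_gradient(2)[OF C1]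
  have c\<zeta>: "continuous_on UNIV \<zeta>"
    using C1 by (rule C1_on_continuous)
  have m\<zeta>: "\<zeta> \<in> borel_measurable borel"
    using c\<zeta> by (rule borel_measurable_continuous_onI)
  obtain R where R: "\<And>x. x \<in> ?S \<Longrightarrow> norm x \<le> R"
    using compact_imp_bounded[OF supp] by (auto simp: bounded_iff)
  have "bounded (grad \<zeta> ` ?S)"
    using supp cg by (meson compact_continuous_image compact_imp_bounded continuous_on_subset subset_UNIV)
  then obtain B0 where "\<And>x. x \<in> ?S \<Longrightarrow> norm (grad \<zeta> x) \<le> B0"
    by (auto simp: bounded_iff)
  \<comment> \<open>If the support is empty, \<open>B0\<close> is arbitrary and may be negative;
    outside the support the gradient is 0. The maximum with 0 covers both situations.\<close>
  then have B: "norm (grad \<zeta> x) \<le> max 0 B0" for x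
    using grad_outside_support[of x \<zeta>] by (cases "x \<in> ?S") (auto simp: max.coboundedI2)
  have lip: "\<bar>\<zeta> y - \<zeta> x\<bar> \<le> max 0 B0 * norm (y - x)" for x y
  proof -
    have "norm (\<zeta> y - \<zeta> x) \<le> max 0 B0 * norm (y - x)"
    proof (rule differentiable_bound[of UNIV \<zeta> "\<lambda>x h. grad \<zeta> x \<bullet> h"])
      show "onorm (\<lambda>h. grad \<zeta> z \<bullet> h) \<le> max 0 B0" for z
      proof (rule onorm_le)
        fix k show "norm (grad \<zeta> z \<bullet> k) \<le> max 0 B0 * norm k"
          using Cauchy_Schwarz_ineq2[of "grad \<zeta> z" k] mult_right_mono[OF B[of z], of "norm k"] by simp
      qed
    qed (use D in auto)
    then show ?thesis by simp
  qed
  define h :: "nat \<Rightarrow> real" where "h n = 1 / real (Suc n)" for n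
  have h: "0 < h n" "h n \<le> 1" for n
    by (auto simp: h_def)
  define e :: "real^'d" where "e = axis i 1"
  have norm_e: "norm e = 1"
    by (simp add: e_def)
  define s where "s n x = (\<zeta> (h n *\<^sub>R e + x) - \<zeta> x) / h n" for n x
  \<comment> \<open>Dominating function for the quotients \<open>s n\<close>. Shifts have length at
    most 1, so beyond radius \<open>R + 1\<close> both values of \<zeta> in the quotient vanish;
    within that radius the Lipschitz bound \<open>lip\<close> applies.\<close>
  define w where "w x = indicator (cball 0 (R + 1)) x *\<^sub>R (max 0 B0)" for x :: "real^'d"
  have int\<zeta>: "integrable lborel \<zeta>"
  proof -
    have "integrable lborel (\<lambda>x. indicator ?S x *\<^sub>R \<zeta> x)"
      using supp c\<zeta> by (intro borel_integrable_compact) (auto intro: continuous_on_subset)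
    moreover have "(\<lambda>x. indicator ?S x *\<^sub>R \<zeta> x) = \<zeta>"
      using closure_subset[of "{x. \<zeta> x \<noteq> 0}"] by (auto simp: fun_eq_iff indicator_def)
    ultimately show ?thesis by simp
  qed
  have int_shift: "integrable lborel (\<lambda>x. \<zeta> (c + x))" for c
    using integrable_distr_eq[of "(+) c" lborel borel \<zeta>] int\<zeta> m\<zeta> by (simp add: lborel_distr_plus)
  have s0: "(LINT x|lborel. s n x) = 0" for n
    unfolding s_def using int_shift int\<zeta> integral_shift[OF m\<zeta>] by simp
  have "(\<lambda>n. LINT x|lborel. s n x) \<longlonglongrightarrow> (LINT x|lborel. grad \<zeta> x $ i)"
  proof (rule integral_dominated_convergence[where w = w])
    have "continuous_on UNIV (\<lambda>x. grad \<zeta> x $ i)"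
      using cg by (intro continuous_intros)
    then show "(\<lambda>x. grad \<zeta> x $ i) \<in> borel_measurable lborel"
      using borel_measurable_continuous_onI by simp
    show "s n \<in> borel_measurable lborel" for n
      unfolding s_def[abs_def] using m\<zeta> by measurable
    show "integrable lborel w"
      unfolding w_def[abs_def] by (intro borel_integrable_compact) auto
    have "(\<lambda>n. s n x) \<longlonglongrightarrow> grad \<zeta> x $ i" for x
    proof -
      have "((\<lambda>t. t *\<^sub>R e + x) has_derivative (\<lambda>t. t *\<^sub>R e)) (at 0)"
        by (auto intro!: derivative_eq_intros)
      from has_derivative_compose[OF this D]
      have "((\<lambda>t. \<zeta> (t *\<^sub>R e + x)) has_derivative (\<lambda>t. grad \<zeta> x \<bullet> (t *\<^sub>R e))) (at 0)"
        by simp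
      moreover have "(\<lambda>t. grad \<zeta> x \<bullet> (t *\<^sub>R e)) = (*) (grad \<zeta> x $ i)"
        by (auto simp: fun_eq_iff e_def inner_axis)
      ultimately have "((\<lambda>t. \<zeta> (t *\<^sub>R e + x)) has_real_derivative grad \<zeta> x $ i) (at 0)"
        by (simp add: has_field_derivative_def)
      then have "(\<lambda>t. (\<zeta> (t *\<^sub>R e + x) - \<zeta> x) / t) \<midarrow>0\<rightarrow> grad \<zeta> x $ i"
        by (simp add: DERIV_def)
      moreover have "filterlim h (at 0) sequentially"
      proof -
        have "h \<longlonglongrightarrow> 0"
          unfolding h_def[abs_def] using LIMSEQ_inverse_real_of_nat by (simp add: inverse_eq_divide)
        then show ?thesis
          using h(1) by (auto simp: filterlim_at less_imp_neq[symmetric] intro!: always_eventually)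
      qed
      ultimately show ?thesis
        unfolding s_def by (rule filterlim_compose)
    qed
    then show "AE x in lborel. (\<lambda>n. s n x) \<longlonglongrightarrow> grad \<zeta> x $ i"
      by simp
    have "norm (s n x) \<le> w x" for n x
    proof (cases "x \<in> cball 0 (R + 1)")
      case True
      have "\<bar>\<zeta> (h n *\<^sub>R e + x) - \<zeta> x\<bar> \<le> max 0 B0 * h n"
        using lip[of "h n *\<^sub>R e + x" x] h[of n] norm_e by simp
      then show ?thesis
        using True h(1)[of n] by (simp add: s_def w_def abs_div divide_le_eq)
    next
      case False
      then have nx: "norm x > R + 1" by simp
      have "norm x \<le> norm (h n *\<^sub>R e + x) + norm (h n *\<^sub>R e)"
        by (metis add_diff_cancel_left' norm_triangle_ineq4)
      moreover have "norm (h n *\<^sub>R e) \<le> 1"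
        using h[of n] norm_e by simp
      ultimately have "norm (h n *\<^sub>R e + x) > R"
        using nx by linarith
      then have "h n *\<^sub>R e + x \<notin> ?S" "x \<notin> ?S"
        using R nx by fastforce+
      then have "\<zeta> (h n *\<^sub>R e + x) = 0" "\<zeta> x = 0"
        using closure_subset[of "{x. \<zeta> x \<noteq> 0}"] by blast+
      then show ?thesis
        by (simp add: s_def w_def)
    qed
    then show "\<And>n. AE x in lborel. norm (s n x) \<le> w x"
      by simp
  qed
  then show ?thesis
    by (simp add: s0 LIMSEQ_const_iff)
qed

section \<open>Square integrability and weak derivatives on the cube\<close>

lemma set_integrable_cube:
  fixes f :: "real^'d \<Rightarrow> real"
  assumes "continuous_on (cube a l) f"
  shows "set_integrable lebesgue (cube a l) f"
  using absolutely_integrable_continuous[of a _ f] assms by (simp add: cube_def)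

lemma continuous_borel_measurable_lebesgue:
  fixes f :: "real^'d \<Rightarrow> real"
  assumes "continuous_on UNIV f"
  shows "f \<in> borel_measurable lebesgue"
  using borel_measurable_continuous_onI[OF assms] by (simp add: measurable_completion)

lemma L2_on_continuous:
  assumes "continuous_on UNIV v"
  shows "L2_on (cube a l) v"
  unfolding L2_on_def
proof
  show "set_borel_measurable lebesgue (cube a l) v"
    unfolding set_borel_measurable_def cube_def real_scaleR_def
    using continuous_borel_measurable_lebesgue[OF assms]
    by (intro borel_measurable_times borel_measurable_indicator) simp_all
  show "set_integrable lebesgue (cube a l) (\<lambda>x. (v x)\<^sup>2)"
    using assms by (intro set_integrable_cube continuous_intros) (auto intro: continuous_on_subset)
qed

text \<open>The product is dominated by the sum of the two squares. Measurability of
  \<open>g\<close> is known only after multiplication by the indicator of the cube, so the indicator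
  is kept attached to \<open>g\<close>.\<close>

lemma L2_on_mult_bounded_integrable:
  assumes g: "L2_on (cube a l) g" and \<zeta>: "continuous_on UNIV \<zeta>"
  shows "set_integrable lebesgue (cube a l) (\<lambda>x. g x * \<zeta> x)"
proof (rule set_integrable_bound)
  show "set_integrable lebesgue (cube a l) (\<lambda>x. (g x)\<^sup>2 + (\<zeta> x)\<^sup>2)"
    using g \<zeta> L2_on_continuous[OF \<zeta>] by (intro set_integral_add) (auto simp: L2_on_def)
  have "(\<lambda>x. indicator (cube a l) x *\<^sub>R g x) \<in> borel_measurable lebesgue"
    using g by (simp add: L2_on_def set_borel_measurable_def)
  then have "(\<lambda>x. (indicator (cube a l) x *\<^sub>R g x) * \<zeta> x) \<in> borel_measurable lebesgue"
    using continuous_borel_measurable_lebesgue[OF \<zeta>] by (rule borel_measurable_times)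
  then show "set_borel_measurable lebesgue (cube a l) (\<lambda>x. g x * \<zeta> x)"
    by (simp add: set_borel_measurable_def mult.assoc)
  have "\<bar>p * q\<bar> \<le> p\<^sup>2 + q\<^sup>2" for p q :: real
  proof -
    have "2 * (\<bar>p\<bar> * \<bar>q\<bar>) \<le> p\<^sup>2 + q\<^sup>2"
      using sum_squares_bound[of "\<bar>p\<bar>" "\<bar>q\<bar>"] by (simp add: mult.assoc)
    moreover have "0 \<le> \<bar>p\<bar> * \<bar>q\<bar>"
      by simp
    ultimately show ?thesis
      by (simp only: abs_mult)
  qed
  then show "AE x in lebesgue. x \<in> cube a l \<longrightarrow> norm (g x * \<zeta> x) \<le> norm ((g x)\<^sup>2 + (\<zeta> x)\<^sup>2)"
    by (intro always_eventually) (auto simp: abs_of_nonneg)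
qed

lemma L2_on_diff:
  assumes "L2_on \<Omega> f" "L2_on \<Omega> g"
  shows "L2_on \<Omega> (\<lambda>x. f x - g x)"
  unfolding L2_on_def
proof
  have "(\<lambda>x. indicator \<Omega> x *\<^sub>R f x - indicator \<Omega> x *\<^sub>R g x) \<in> borel_measurable lebesgue"
    using assms unfolding L2_on_def set_borel_measurable_def by (intro borel_measurable_diff) auto
  then show m: "set_borel_measurable lebesgue \<Omega> (\<lambda>x. f x - g x)"
    by (simp add: set_borel_measurable_def right_diff_distrib)
  show "set_integrable lebesgue \<Omega> (\<lambda>x. (f x - g x)\<^sup>2)"
  proof (rule set_integrable_bound)
    show "set_integrable lebesgue \<Omega> (\<lambda>x. 2 * (f x)\<^sup>2 + 2 * (g x)\<^sup>2)"
      using assms by (intro set_integral_add set_integrable_mult_right) (auto simp: L2_on_def)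
    have "(\<lambda>x. (indicator \<Omega> x *\<^sub>R (f x - g x))\<^sup>2) \<in> borel_measurable lebesgue"
      using m unfolding set_borel_measurable_def by (rule borel_measurable_power)
    moreover have "(\<lambda>x. (indicator \<Omega> x *\<^sub>R (f x - g x))\<^sup>2) = (\<lambda>x. indicator \<Omega> x *\<^sub>R (f x - g x)\<^sup>2)"
      by (auto simp: fun_eq_iff indicator_def)
    ultimately show "set_borel_measurable lebesgue \<Omega> (\<lambda>x. (f x - g x)\<^sup>2)"
      by (simp add: set_borel_measurable_def)
    have "(p - q)\<^sup>2 \<le> 2 * p\<^sup>2 + 2 * q\<^sup>2" for p q :: real
      using zero_le_power2[of "p + q"] by (simp add: power2_sum power2_diff)
    then show "AE x in lebesgue. x \<in> \<Omega> \<longrightarrow> norm ((f x - g x)\<^sup>2) \<le> norm (2 * (f x)\<^sup>2 + 2 * (g x)\<^sup>2)"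
      by (intro always_eventually) (auto simp: abs_of_nonneg)
  qed
qed

text \<open>The integral of a nonintegrable function is 0 by convention, so linearity needs each of
  the four products with \<zeta> or its gradient to be integrable. Continuity of \<open>v\<close>,
  \<open>w\<close> and square integrability of \<open>g\<close>, \<open>h\<close> secure
  this.\<close>

lemma has_weak_partial_diff:
  assumes v: "continuous_on UNIV v" "L2_on (cube a l) g" "has_weak_partial (cube a l) i v g"
    and w: "continuous_on UNIV w" "L2_on (cube a l) h" "has_weak_partial (cube a l) i w h"
  shows "has_weak_partial (cube a l) i (\<lambda>x. v x - w x) (\<lambda>x. g x - h x)"
  unfolding has_weak_partial_def
proof (intro allI impI)
  fix \<zeta> :: "real^'a \<Rightarrow> real"
  assume \<zeta>: "C1_on UNIV \<zeta> \<and> compact (closure {x. \<zeta> x \<noteq> 0}) \<and> closure {x. \<zeta> x \<noteq> 0} \<subseteq> interior (cube a l)"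
  then have c: "continuous_on UNIV \<zeta>" "continuous_on UNIV (\<lambda>x. grad \<zeta> x $ i)"
    using C1_on_continuous C1_on_UNIV_gradient(2) by (auto intro!: continuous_intros)
  have i1: "set_integrable lebesgue (cube a l) (\<lambda>x. v x * grad \<zeta> x $ i)"
    "set_integrable lebesgue (cube a l) (\<lambda>x. w x * grad \<zeta> x $ i)"
    using v(1) w(1) c(2) by (auto intro!: L2_on_mult_bounded_integrable L2_on_continuous)
  have i2: "set_integrable lebesgue (cube a l) (\<lambda>x. g x * \<zeta> x)"
    "set_integrable lebesgue (cube a l) (\<lambda>x. h x * \<zeta> x)"
    using v(2) w(2) c(1) by (auto intro!: L2_on_mult_bounded_integrable)
  show "(LINT x:cube a l|lebesgue. (v x - w x) * grad \<zeta> x $ i) = - (LINT x:cube a l|lebesgue. (g x - h x) * \<zeta> x)"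
    using v(3) w(3) \<zeta> set_integral_diff(2)[OF i1] set_integral_diff(2)[OF i2]
    unfolding has_weak_partial_def by (simp add: left_diff_distrib)
qed

text \<open>The support of \<zeta> lies inside the cube, so the integral of the partial derivative
  over the cube equals the one over the whole space, which is zero.\<close>

lemma has_weak_partial_one: "has_weak_partial (cube a l) i (\<lambda>x. 1) (\<lambda>x. 0)"
  unfolding has_weak_partial_def
proof (intro allI impI)
  fix \<zeta> :: "real^'a \<Rightarrow> real"
  assume \<zeta>: "C1_on UNIV \<zeta> \<and> compact (closure {x. \<zeta> x \<noteq> 0}) \<and> closure {x. \<zeta> x \<noteq> 0} \<subseteq> interior (cube a l)"
  then have "x \<notin> cube a l \<Longrightarrow> grad \<zeta> x = 0" for x
    using grad_outside_support interior_subset by blast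
  then have "(LINT x:cube a l|lebesgue. grad \<zeta> x $ i) = (LINT x|lebesgue. grad \<zeta> x $ i)"
    unfolding set_lebesgue_integral_def by (intro Bochner_Integration.integral_cong) (auto simp: indicator_def)
  also have "\<dots> = (LINT x|lborel. grad \<zeta> x $ i)"
    using \<zeta> C1_on_UNIV_gradient(2)[of \<zeta>]
    by (intro integral_completion) (auto intro!: borel_measurable_continuous_onI continuous_intros)
  also have "\<dots> = 0"
    using \<zeta> by (intro integral_partial_eq_0) auto
  finally show "(LINT x:cube a l|lebesgue. 1 * grad \<zeta> x $ i) = - (LINT x:cube a l|lebesgue. 0 * \<zeta> x)"
    by (simp add: set_lebesgue_integral_def)
qed

lemma one_in_fe_space: "(\<lambda>x. 1) \<in> fe_space k a l \<T>"
proof -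
  have "L2_on (cube a l) (\<lambda>x. c)" for c
    by (rule L2_on_continuous) simp
  then have "H1_on (cube a l) (\<lambda>x. 1)"
    using has_weak_partial_one unfolding H1_on_def by blast
  then show ?thesis
    using one_in_poly_deg unfolding fe_space_def periodic_def
    by (intro CollectI conjI ballI bexI[of _ "\<lambda>x. 1"]) auto
qed

text \<open>Makes the increment of the phase field an admissible test function for the potential
  equation and gives its gradient a piecewise continuous form.\<close>

lemma fe_space_diff:
  assumes v: "v \<in> fe_space k a l \<T>" and w: "w \<in> fe_space k a l \<T>"
  shows "(\<lambda>x. v x - w x) \<in> fe_space k a l \<T>"
proof -
  have cv: "continuous_on UNIV v" and cw: "continuous_on UNIV w"
    using v w by (auto simp: fe_space_def)
  have "\<exists>g. L2_on (cube a l) g \<and> has_weak_partial (cube a l) i (\<lambda>x. v x - w x) g" for i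
  proof -
    obtain g h where "L2_on (cube a l) g" "has_weak_partial (cube a l) i v g"
      "L2_on (cube a l) h" "has_weak_partial (cube a l) i w h"
      using v w unfolding fe_space_def H1_on_def by blast
    then show ?thesis
      using has_weak_partial_diff[OF cv _ _ cw] L2_on_diff by blast
  qed
  moreover have "continuous_on UNIV (\<lambda>x. v x - w x)"
    using cv cw by (rule continuous_on_diff)
  moreover have "\<exists>p\<in>poly_deg k. \<forall>x\<in>K. v x - w x = p x" if K: "K \<in> \<T>" for K
  proof -
    obtain p q where "p \<in> poly_deg k" "\<forall>x\<in>K. v x = p x" "q \<in> poly_deg k" "\<forall>x\<in>K. w x = q x"
      using v w K unfolding fe_space_def by blast
    then show ?thesis
      using poly_deg_diff by (intro bexI[of _ "\<lambda>x. p x - q x"]) auto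
  qed
  moreover have "periodic l (\<lambda>x. v x - w x)"
    using v w by (auto simp: fe_space_def periodic_def)
  ultimately show ?thesis
    unfolding fe_space_def H1_on_def using L2_on_continuous by blast
qed

lemma one_in_Vhp: "(\<lambda>x. 1) \<in> Vhp a l \<T>"
  by (simp add: Vhp_def Vh_def one_in_fe_space)

lemma grad_const: "grad (\<lambda>x. c) = (\<lambda>x. 0)"
  by (rule ext, rule grad_eqI) simp

section \<open>Discretised constitutive relations\<close>

text \<open>Serves twice: to select three intermediate values at each point of the cube, and three
  intermediate functions for each time step.\<close>

lemma choice3:
  assumes "\<And>x. x \<in> A \<Longrightarrow> \<exists>p q r. P x p q r"
  shows "\<exists>f g h. \<forall>x\<in>A. P x (f x) (g x) (h x)"
  using assms by metis

lemma outer_vector_mult: "outer p q *v v = (q \<bullet> v) *\<^sub>R p"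
  by (simp add: vec_eq_iff outer_def matrix_vector_mult_def inner_vec_def sum_distrib_left mult_ac)

lemma sigma_vector_mult: "sigma M \<phi> \<theta> x *v v = (gam M / \<theta> x * (grad \<phi> x \<bullet> v)) *\<^sub>R grad \<phi> x"
  by (simp add: sigma_def scaleR_matrix_vector_assoc[symmetric] outer_vector_mult)

lemma sum_UNIV_Plus:
  fixes f :: "'a::finite + 'b::finite \<Rightarrow> 'c::comm_monoid_add"
  shows "(\<Sum>i\<in>UNIV. f i) = (\<Sum>i\<in>UNIV. f (Inl i)) + (\<Sum>i\<in>UNIV. f (Inr i))"
  by (simp add: UNIV_Plus_UNIV[symmetric] sum.Plus del: UNIV_Plus_UNIV)

lemma inner_vpair: "vpair p q \<bullet> vpair p' q' = p \<bullet> p' + q \<bullet> q'"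
  by (simp add: inner_vec_def vpair_def sum_UNIV_Plus)

lemma block_vpair: "block A B C D *v vpair p q = vpair (A *v p + B *v q) (C *v p + D *v q)"
  by (auto simp: vec_eq_iff block_def vpair_def matrix_vector_mult_def sum_UNIV_Plus split: sum.split)

lemma uminus_matrix_vector_mult: "(- A) *v v = - (A *v v)" for A :: "real^'n^'m"
  by (simp add: vec_eq_iff matrix_vector_mult_def sum_negf)

text \<open>With \<open>p\<close> and \<open>q\<close> the gradients of \<mu> and \<theta>, the
  first term is the flux term of the phase equation tested with \<mu>, the second the negative of
  the flux term of the energy equation tested with \<theta>.\<close>

lemma Lmat_quadratic_form:
  "vpair p q \<bullet> (Lmat M r g s *v vpair p q)
   = (L11 M r g s *v p - L12 M r g s *v q) \<bullet> p - (L12 M r g s *v p - L22 M r g s *v q) \<bullet> q"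
  by (simp add: Lmat_def block_vpair inner_vpair uminus_matrix_vector_mult inner_diff_left
      inner_diff_right inner_add_right inner_commute)

lemma pwc_divide:
  assumes "pwc \<T> UNIV f" "pwc \<T> {0<..} g"
  shows "pwc \<T> UNIV (\<lambda>x. f x / g x :: real)"
  using pwc_mult[OF assms(1) pwc_inverse[OF assms(2)]] by (simp add: divide_inverse)

lemma pwc_divide_power2:
  assumes "pwc \<T> UNIV f" "pwc \<T> {0<..} g"
  shows "pwc \<T> UNIV (\<lambda>x. f x / (g x)\<^sup>2 :: real)"
  using pwc_divide[OF pwc_divide[OF assms] assms(2)] by (simp add: power2_eq_square)

lemmas pwc_rules = pwc_const pwc_add pwc_diff pwc_scaleR pwc_mult pwc_inner
  pwc_matrix_vector_mult pwc_norm_power2 pwc_divide pwc_divide_power2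

lemma Vh_pwc: "v \<in> Vh a l \<T> \<Longrightarrow> pwc \<T> UNIV v" and Vh_pwc_grad: "v \<in> Vh a l \<T> \<Longrightarrow> pwc \<T> UNIV (grad v)"
  by (auto simp: Vh_def intro: pwc_fe pwc_grad)

lemma Vhp_imp_Vh: "v \<in> Vhp a l \<T> \<Longrightarrow> v \<in> Vh a l \<T>"
  by (simp add: Vhp_def)

context mesh
begin

lemma Vhp_pwc: "v \<in> Vhp a l \<T> \<Longrightarrow> pwc \<T> {0<..} v"
  by (rule pwc_continuous) (auto simp: Vhp_def Vh_def fe_space_def Union_mesh)

lemma ip_cong:
  assumes "pwc \<T> UNIV f" and "\<And>x. x \<in> \<Omega>o \<Longrightarrow> f x = u x \<bullet> v x"
  shows "ip \<Omega> u v = (LINT x:\<Omega>|lebesgue. f x)"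
  unfolding ip_def using pwc_integral_cong[OF assms] by simp

lemma pwc_integral_add:
  fixes f g :: "real^'d \<Rightarrow> real"
  assumes "pwc \<T> UNIV f" "pwc \<T> UNIV g"
  shows "(LINT x:\<Omega>|lebesgue. f x + g x) = (LINT x:\<Omega>|lebesgue. f x) + (LINT x:\<Omega>|lebesgue. g x)"
  using assms by (intro set_integral_add pwc_integrable)

lemma pwc_integral_diff:
  fixes f g :: "real^'d \<Rightarrow> real"
  assumes "pwc \<T> UNIV f" "pwc \<T> UNIV g"
  shows "(LINT x:\<Omega>|lebesgue. f x - g x) = (LINT x:\<Omega>|lebesgue. f x) - (LINT x:\<Omega>|lebesgue. g x)"
  using assms by (intro set_integral_diff pwc_integrable)

lemma pwc_integral_telescope:
  fixes g :: "nat \<Rightarrow> real^'d \<Rightarrow> real"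
  assumes "\<And>k. k \<le> Suc n \<Longrightarrow> pwc \<T> UNIV (g k)"
  shows "(LINT x:\<Omega>|lebesgue. g (Suc n) x - g 0 x) = (\<Sum>k\<le>n. LINT x:\<Omega>|lebesgue. g (Suc k) x - g k x)"
  using assms by (induction n) (simp_all add: pwc_integral_diff)

lemma cube_sets: "\<Omega> \<in> sets lebesgue"
  by (simp add: cube_def)

end

section \<open>Constitutive functions along finite element states\<close>

locale discretised_model = mesh a l \<T> for a :: "real^'d::finite" and l :: real and \<T> +
  fixes M :: "'d model"
  assumes visc_pos: "\<And>p r. r > 0 \<Longrightarrow> visc M p r > 0"
    and gam_pos: "gam M > 0"
    and concave: "\<And>p. concave_on {0<..} (Psi M p)"
    and split: "\<And>p r. r > 0 \<Longrightarrow> Psi M p r = Psivex M p r + Psicav M p r"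
    and vex: "\<And>r. r > 0 \<Longrightarrow> strictly_convex_on UNIV (\<lambda>p. Psivex M p r)"
    and cav: "\<And>r. r > 0 \<Longrightarrow> strictly_concave_on UNIV (\<lambda>p. Psicav M p r)"
    and C2_Psi: "C2_on (UNIV \<times> {0<..}) (\<lambda>(p, r). Psi M p r)"
    and C2_vex: "C2_on (UNIV \<times> {0<..}) (\<lambda>(p, r). Psivex M p r)"
    and C2_cav: "C2_on (UNIV \<times> {0<..}) (\<lambda>(p, r). Psicav M p r)"
    and C1_visc: "C1_on (UNIV \<times> {0<..}) (\<lambda>(p, r). visc M p r)"
    and C1_L: "C1_on (UNIV \<times> UNIV \<times> {0<..}) (\<lambda>(p, g, r). Lmat M p g r)"
begin

text \<open>Constitutive functions are continuous for positive temperature only. Elements of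
  \<open>Vhp\<close> are positive on the closed cube, which keeps the pair of extensions in
  \<open>UNIV \<times> {0<..}\<close> up to the cell boundaries.\<close>

lemma pwc_state:
  assumes "\<phi> \<in> Vh a l \<T>" "\<theta> \<in> Vhp a l \<T>" "continuous_on (UNIV \<times> {0<..}) (\<lambda>(p, r). F p r)"
  shows "pwc \<T> UNIV (\<lambda>x. F (\<phi> x) (\<theta> x))"
  using pwc_comp[OF pwc_Pair[OF Vh_pwc[OF assms(1)] Vhp_pwc[OF assms(2)]] assms(3)] by simp

lemma pwc_visc:
  assumes "\<phi> \<in> Vh a l \<T>" "\<theta> \<in> Vhp a l \<T>"
  shows "pwc \<T> UNIV (\<lambda>x. visc M (\<phi> x) (\<theta> x))"
  using pwc_state[OF assms C1_on_continuous[OF C1_visc]] .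

lemma pwc_Lmat:
  assumes "\<phi> \<in> Vh a l \<T>" "\<theta> \<in> Vhp a l \<T>"
  shows "pwc \<T> UNIV (\<lambda>x. Lmat M (\<phi> x) (grad \<phi> x) (\<theta> x))"
  using pwc_comp[OF pwc_Pair[OF Vh_pwc[OF assms(1)] pwc_Pair[OF Vh_pwc_grad[OF assms(1)] Vhp_pwc[OF assms(2)]]]
      C1_on_continuous[OF C1_L]] by simp

text \<open>Regularity is assumed of the full matrix \<open>Lmat\<close>, so each block is recovered
  entry by entry, with a change of sign for \<open>L12\<close>.\<close>

lemma
  assumes "\<phi> \<in> Vh a l \<T>" "\<theta> \<in> Vhp a l \<T>"
  shows pwc_L11: "pwc \<T> UNIV (\<lambda>x. L11 M (\<phi> x) (grad \<phi> x) (\<theta> x))"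
    and pwc_L12: "pwc \<T> UNIV (\<lambda>x. L12 M (\<phi> x) (grad \<phi> x) (\<theta> x))"
    and pwc_L22: "pwc \<T> UNIV (\<lambda>x. L22 M (\<phi> x) (grad \<phi> x) (\<theta> x))"
proof -
  have e: "L11 M p g r $ i $ j = Lmat M p g r $ Inl i $ Inl j"
    "L12 M p g r $ i $ j = - Lmat M p g r $ Inl i $ Inr j"
    "L22 M p g r $ i $ j = Lmat M p g r $ Inr i $ Inr j" for p g r i j
    by (simp_all add: Lmat_def block_def)
  have "pwc \<T> UNIV (\<lambda>x. Lmat M (\<phi> x) (grad \<phi> x) (\<theta> x) $ i $ j)"
    "pwc \<T> UNIV (\<lambda>x. - Lmat M (\<phi> x) (grad \<phi> x) (\<theta> x) $ i $ j)" for i j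
    by (rule pwc_comp[OF pwc_Lmat[OF assms]]; intro continuous_intros)+
  then show "pwc \<T> UNIV (\<lambda>x. L11 M (\<phi> x) (grad \<phi> x) (\<theta> x))"
    "pwc \<T> UNIV (\<lambda>x. L12 M (\<phi> x) (grad \<phi> x) (\<theta> x))"
    "pwc \<T> UNIV (\<lambda>x. L22 M (\<phi> x) (grad \<phi> x) (\<theta> x))"
    by (auto intro!: pwc_vec simp only: e)
qed

lemma pwc_energy:
  assumes "\<phi> \<in> Vh a l \<T>" "\<theta> \<in> Vhp a l \<T>"
  shows "pwc \<T> UNIV (energy M \<phi> \<theta>)"
  using pwc_state[OF assms C2_on_partials(5)[OF C2_Psi]] by (simp add: energy_def[abs_def])

lemma pwc_entropy:
  assumes "\<phi> \<in> Vh a l \<T>" "\<theta> \<in> Vhp a l \<T>"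
  shows "pwc \<T> UNIV (entropy M \<phi> \<theta>)"
  unfolding entropy_def[abs_def] Psitilde_def
  by (intro pwc_rules pwc_energy[OF assms] pwc_weaken[OF Vhp_pwc[OF assms(2)]] Vh_pwc_grad[OF assms(1)]
      pwc_state[OF assms C2_on_partials(3)[OF C2_Psi]])

lemma pwc_sigma_mult:
  assumes "\<phi> \<in> Vh a l \<T>" "\<theta> \<in> Vhp a l \<T>" "pwc \<T> UNIV v"
  shows "pwc \<T> UNIV (\<lambda>x. sigma M \<phi> \<theta> x *v v x)"
  unfolding sigma_vector_mult
  by (intro pwc_rules assms(3) Vh_pwc_grad[OF assms(1)] Vhp_pwc[OF assms(2)])

text \<open>The numerical dissipation density with its second-order terms written as Taylor remainders.
  In this form it is integrable although the intermediate points \<open>\<xi>\<close>, chosen pointwise,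
  need not be measurable.\<close>

definition remainder ::
  "(real^'d \<Rightarrow> real) \<Rightarrow> (real^'d \<Rightarrow> real) \<Rightarrow> (real^'d \<Rightarrow> real) \<Rightarrow> (real^'d \<Rightarrow> real) \<Rightarrow> real^'d \<Rightarrow> real" where
  "remainder \<phi>0 \<phi>1 \<theta>0 \<theta>1 x =
     gam M / 2 * (norm (grad (\<lambda>y. \<phi>1 y - \<phi>0 y) x))\<^sup>2
     - (Psi M (\<phi>0 x) (\<theta>1 x) - Psi M (\<phi>0 x) (\<theta>0 x) - d\<theta> (Psi M) (\<phi>0 x) (\<theta>0 x) * (\<theta>1 x - \<theta>0 x))
     + (Psivex M (\<phi>0 x) (\<theta>1 x) - Psivex M (\<phi>1 x) (\<theta>1 x)
        - d\<phi> (Psivex M) (\<phi>1 x) (\<theta>1 x) * (\<phi>0 x - \<phi>1 x))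
     - (Psicav M (\<phi>1 x) (\<theta>1 x) - Psicav M (\<phi>0 x) (\<theta>1 x)
        - d\<phi> (Psicav M) (\<phi>0 x) (\<theta>1 x) * (\<phi>1 x - \<phi>0 x))"

lemma pwc_remainder:
  assumes "\<phi>0 \<in> Vh a l \<T>" "\<phi>1 \<in> Vh a l \<T>" "\<theta>0 \<in> Vhp a l \<T>" "\<theta>1 \<in> Vhp a l \<T>"
  shows "pwc \<T> UNIV (remainder \<phi>0 \<phi>1 \<theta>0 \<theta>1)"
proof -
  have "(\<lambda>y. \<phi>1 y - \<phi>0 y) \<in> Vh a l \<T>"
    using assms by (simp add: Vh_def fe_space_diff)
  note facts = Vh_pwc_grad[OF this]
    Vh_pwc[OF assms(1)] Vh_pwc[OF assms(2)] pwc_weaken[OF Vhp_pwc[OF assms(3)]] pwc_weaken[OF Vhp_pwc[OF assms(4)]]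
    pwc_state[OF assms(1,3) C2_on_partials(3)[OF C2_Psi]] pwc_state[OF assms(1,4) C2_on_partials(3)[OF C2_Psi]]
    pwc_state[OF assms(1,3) C2_on_partials(5)[OF C2_Psi]]
    pwc_state[OF assms(1,4) C2_on_partials(3)[OF C2_vex]] pwc_state[OF assms(2,4) C2_on_partials(3)[OF C2_vex]]
    pwc_state[OF assms(2,4) C2_on_partials(4)[OF C2_vex]]
    pwc_state[OF assms(1,4) C2_on_partials(3)[OF C2_cav]] pwc_state[OF assms(2,4) C2_on_partials(3)[OF C2_cav]]
    pwc_state[OF assms(1,4) C2_on_partials(4)[OF C2_cav]]
  show ?thesis
    unfolding remainder_def[abs_def] by (intro pwc_rules facts)
qed

text \<open>Each bracket is the gap between a function and its tangent, whose sign follows from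
  convexity, applied to the negated function in the concave cases. The gradient term is a
  nonnegative multiple of a square.\<close>

lemma remainder_nonneg:
  assumes "\<theta>0 x > 0" "\<theta>1 x > 0"
  shows "remainder \<phi>0 \<phi>1 \<theta>0 \<theta>1 x \<ge> 0"
proof -
  have "((\<lambda>r. - Psi M (\<phi>0 x) r) has_real_derivative - d\<theta> (Psi M) (\<phi>0 x) (\<theta>0 x)) (at (\<theta>0 x) within {0<..})"
    using DERIV_minus[OF C2_on_partials(2)[OF C2_Psi assms(1)]] by (rule has_field_derivative_at_within)
  from convex_on_imp_above_tangent[OF _ _ _ _ this, of "\<theta>1 x"]
  have 1: "Psi M (\<phi>0 x) (\<theta>1 x) - Psi M (\<phi>0 x) (\<theta>0 x) \<le> d\<theta> (Psi M) (\<phi>0 x) (\<theta>0 x) * (\<theta>1 x - \<theta>0 x)"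
    using concave[of "\<phi>0 x"] assms by (simp add: concave_on_def interior_open)
  have 2: "Psivex M (\<phi>0 x) (\<theta>1 x) - Psivex M (\<phi>1 x) (\<theta>1 x)
      \<ge> d\<phi> (Psivex M) (\<phi>1 x) (\<theta>1 x) * (\<phi>0 x - \<phi>1 x)"
    using convex_on_imp_above_tangent[OF strictly_convex_on_imp_convex_on[OF vex[OF assms(2)]], of "\<phi>1 x" "\<phi>0 x"]
      C2_on_partials(1)[OF C2_vex assms(2)] by simp
  have "((\<lambda>p. - Psicav M p (\<theta>1 x)) has_real_derivative - d\<phi> (Psicav M) (\<phi>0 x) (\<theta>1 x)) (at (\<phi>0 x) within UNIV)"
    using DERIV_minus[OF C2_on_partials(1)[OF C2_cav assms(2)]] by simp
  from convex_on_imp_above_tangent[OF strictly_convex_on_imp_convex_on[OF cav[OF assms(2), unfolded strictly_concave_on_def]]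
      _ _ _ this, of "\<phi>1 x"]
  have 3: "Psicav M (\<phi>1 x) (\<theta>1 x) - Psicav M (\<phi>0 x) (\<theta>1 x)
      \<le> d\<phi> (Psicav M) (\<phi>0 x) (\<theta>1 x) * (\<phi>1 x - \<phi>0 x)"
    by simp
  have "0 \<le> gam M / 2 * (norm (grad (\<lambda>y. \<phi>1 y - \<phi>0 y) x))\<^sup>2"
    using gam_pos by simp
  with 1 2 3 show ?thesis
    unfolding remainder_def by linarith
qed

lemma remainder_eq_num_diss_density:
  assumes "\<And>x. x \<in> \<Omega> \<Longrightarrow> \<theta>0 x > 0" "\<And>x. x \<in> \<Omega> \<Longrightarrow> \<theta>1 x > 0"
  shows "\<exists>\<xi>1 \<xi>2 \<xi>3. \<forall>x\<in>\<Omega>. \<xi>1 x \<in> closed_segment (\<phi>1 x) (\<phi>0 x) \<and> \<xi>2 x \<in> closed_segment (\<phi>1 x) (\<phi>0 x)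
     \<and> \<xi>3 x \<in> closed_segment (\<theta>1 x) (\<theta>0 x)
     \<and> num_diss_density M \<phi>0 \<phi>1 \<theta>0 \<theta>1 \<xi>1 \<xi>2 \<xi>3 x = remainder \<phi>0 \<phi>1 \<theta>0 \<theta>1 x"
proof -
  have "\<exists>z1 z2 z3. z1 \<in> closed_segment (\<phi>1 x) (\<phi>0 x) \<and> z2 \<in> closed_segment (\<phi>1 x) (\<phi>0 x)
     \<and> z3 \<in> closed_segment (\<theta>1 x) (\<theta>0 x)
     \<and> gam M / 2 * (norm (grad (\<lambda>y. \<phi>1 y - \<phi>0 y) x))\<^sup>2
       - (1/2) * d\<theta> (d\<theta> (Psi M)) (\<phi>0 x) z3 * (\<theta>1 x - \<theta>0 x)\<^sup>2
       + (1/2) * (d\<phi> (d\<phi> (Psivex M)) z1 (\<theta>1 x) - d\<phi> (d\<phi> (Psicav M)) z2 (\<theta>1 x)) * (\<phi>1 x - \<phi>0 x)\<^sup>2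
       = remainder \<phi>0 \<phi>1 \<theta>0 \<theta>1 x" if x: "x \<in> \<Omega>" for x
  proof -
    note pos = assms[OF x]
    \<comment> \<open>Second derivatives in temperature are controlled on the positive half-line
      only, so the whole segment must stay inside it.\<close>
    have seg: "z > 0" if "z \<in> closed_segment (\<theta>0 x) (\<theta>1 x)" for z
      using that pos by (auto simp: closed_segment_eq_real_ivl split: if_splits)
    obtain z1 where z1: "z1 \<in> closed_segment (\<phi>1 x) (\<phi>0 x)"
      "Psivex M (\<phi>0 x) (\<theta>1 x) = Psivex M (\<phi>1 x) (\<theta>1 x) + d\<phi> (Psivex M) (\<phi>1 x) (\<theta>1 x) * (\<phi>0 x - \<phi>1 x)
        + (1/2) * d\<phi> (d\<phi> (Psivex M)) z1 (\<theta>1 x) * (\<phi>0 x - \<phi>1 x)\<^sup>2"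
      using second_order_Taylor[of "\<phi>1 x" "\<phi>0 x" "\<lambda>p. Psivex M p (\<theta>1 x)" "\<lambda>p. d\<phi> (Psivex M) p (\<theta>1 x)"
          "\<lambda>p. d\<phi> (d\<phi> (Psivex M)) p (\<theta>1 x)"] C2_on_partials(1,6)[OF C2_vex pos(2)] by blast
    obtain z2 where z2: "z2 \<in> closed_segment (\<phi>0 x) (\<phi>1 x)"
      "Psicav M (\<phi>1 x) (\<theta>1 x) = Psicav M (\<phi>0 x) (\<theta>1 x) + d\<phi> (Psicav M) (\<phi>0 x) (\<theta>1 x) * (\<phi>1 x - \<phi>0 x)
        + (1/2) * d\<phi> (d\<phi> (Psicav M)) z2 (\<theta>1 x) * (\<phi>1 x - \<phi>0 x)\<^sup>2"
      using second_order_Taylor[of "\<phi>0 x" "\<phi>1 x" "\<lambda>p. Psicav M p (\<theta>1 x)" "\<lambda>p. d\<phi> (Psicav M) p (\<theta>1 x)"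
          "\<lambda>p. d\<phi> (d\<phi> (Psicav M)) p (\<theta>1 x)"] C2_on_partials(1,6)[OF C2_cav pos(2)] by blast
    obtain z3 where z3: "z3 \<in> closed_segment (\<theta>0 x) (\<theta>1 x)"
      "Psi M (\<phi>0 x) (\<theta>1 x) = Psi M (\<phi>0 x) (\<theta>0 x) + d\<theta> (Psi M) (\<phi>0 x) (\<theta>0 x) * (\<theta>1 x - \<theta>0 x)
        + (1/2) * d\<theta> (d\<theta> (Psi M)) (\<phi>0 x) z3 * (\<theta>1 x - \<theta>0 x)\<^sup>2"
      using second_order_Taylor[of "\<theta>0 x" "\<theta>1 x" "Psi M (\<phi>0 x)" "d\<theta> (Psi M) (\<phi>0 x)"
          "d\<theta> (d\<theta> (Psi M)) (\<phi>0 x)"] C2_on_partials(2,7)[OF C2_Psi seg] by blast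
    have "gam M / 2 * (norm (grad (\<lambda>y. \<phi>1 y - \<phi>0 y) x))\<^sup>2
       - (1/2) * d\<theta> (d\<theta> (Psi M)) (\<phi>0 x) z3 * (\<theta>1 x - \<theta>0 x)\<^sup>2
       + (1/2) * (d\<phi> (d\<phi> (Psivex M)) z1 (\<theta>1 x) - d\<phi> (d\<phi> (Psicav M)) z2 (\<theta>1 x)) * (\<phi>1 x - \<phi>0 x)\<^sup>2
       = remainder \<phi>0 \<phi>1 \<theta>0 \<theta>1 x"
      unfolding remainder_def z1(2) z2(2) z3(2) by (simp add: left_diff_distrib power2_commute right_diff_distrib)
    then show ?thesis
      using z1(1) z2(1) z3(1) unfolding closed_segment_commute[of "\<phi>0 x"] closed_segment_commute[of "\<theta>0 x"]
      by blast
  qed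
  then show ?thesis
    unfolding num_diss_density_def by (rule choice3)
qed

lemma remainder_integral_nonneg:
  assumes "\<theta>0 \<in> Vhp a l \<T>" "\<theta>1 \<in> Vhp a l \<T>"
  shows "0 \<le> (LINT x:\<Omega>|lebesgue. remainder \<phi>0 \<phi>1 \<theta>0 \<theta>1 x)"
  unfolding set_lebesgue_integral_def
  using assms remainder_nonneg by (intro Bochner_Integration.integral_nonneg) (auto simp: Vhp_def indicator_def)

text \<open>The density equals \<open>remainder\<close> at every point of the cube, including the
  \<open>skeleton\<close>, where both contain the same gradient expression. Integrability and the
  value of the integral are therefore inherited directly.\<close>

lemma num_diss_exists:
  assumes "\<phi>0 \<in> Vh a l \<T>" "\<phi>1 \<in> Vh a l \<T>" "\<theta>0 \<in> Vhp a l \<T>" "\<theta>1 \<in> Vhp a l \<T>"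
  shows "\<exists>\<xi>1 \<xi>2 \<xi>3. (\<forall>x\<in>\<Omega>. \<xi>1 x \<in> closed_segment (\<phi>1 x) (\<phi>0 x) \<and> \<xi>2 x \<in> closed_segment (\<phi>1 x) (\<phi>0 x)
       \<and> \<xi>3 x \<in> closed_segment (\<theta>1 x) (\<theta>0 x))
     \<and> set_integrable lebesgue \<Omega> (num_diss_density M \<phi>0 \<phi>1 \<theta>0 \<theta>1 \<xi>1 \<xi>2 \<xi>3)
     \<and> (LINT x:\<Omega>|lebesgue. num_diss_density M \<phi>0 \<phi>1 \<theta>0 \<theta>1 \<xi>1 \<xi>2 \<xi>3 x)
       = (LINT x:\<Omega>|lebesgue. remainder \<phi>0 \<phi>1 \<theta>0 \<theta>1 x)"
proof -
  have pos: "\<theta>0 x > 0" "\<theta>1 x > 0" if "x \<in> \<Omega>" for x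
    using assms(3,4) that by (auto simp: Vhp_def)
  obtain \<xi>1 \<xi>2 \<xi>3 where
    \<xi>: "\<forall>x\<in>\<Omega>. \<xi>1 x \<in> closed_segment (\<phi>1 x) (\<phi>0 x) \<and> \<xi>2 x \<in> closed_segment (\<phi>1 x) (\<phi>0 x)
     \<and> \<xi>3 x \<in> closed_segment (\<theta>1 x) (\<theta>0 x)
     \<and> num_diss_density M \<phi>0 \<phi>1 \<theta>0 \<theta>1 \<xi>1 \<xi>2 \<xi>3 x = remainder \<phi>0 \<phi>1 \<theta>0 \<theta>1 x"
    using remainder_eq_num_diss_density[of \<theta>0 \<theta>1, OF pos] by blast
  have "set_integrable lebesgue \<Omega> (num_diss_density M \<phi>0 \<phi>1 \<theta>0 \<theta>1 \<xi>1 \<xi>2 \<xi>3)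
      = set_integrable lebesgue \<Omega> (remainder \<phi>0 \<phi>1 \<theta>0 \<theta>1)"
    using \<xi> by (intro set_integrable_cong) auto
  moreover have "(LINT x:\<Omega>|lebesgue. num_diss_density M \<phi>0 \<phi>1 \<theta>0 \<theta>1 \<xi>1 \<xi>2 \<xi>3 x)
       = (LINT x:\<Omega>|lebesgue. remainder \<phi>0 \<phi>1 \<theta>0 \<theta>1 x)"
    using \<xi> by (intro set_lebesgue_integral_cong cube_sets) auto
  ultimately show ?thesis
    using \<xi> pwc_integrable[OF pwc_remainder[OF assms]] by blast
qed

end

section \<open>One step of the scheme\<close>

text \<open>The starred fields are parameters of their own, tied to neither time level, so explicit
  and implicit evaluation are treated at once. Likewise membership of \<open>uh\<close> in
  \<open>Xh\<close> is an assumption, to be supplied by piecewise linearity in time.\<close>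

locale scheme_step = discretised_model a l \<T> M
  for a :: "real^'d::finite" and l :: real and \<T> and M :: "'d model" +
  fixes \<tau> :: real and \<phi>0 \<phi>1 \<phi>s \<theta>0 \<theta>1 \<theta>s \<mu>1 \<mu>s \<pi>1 :: "real^'d \<Rightarrow> real" and u0 u1 us uh :: "real^'d \<Rightarrow> real^'d"
  assumes \<tau>: "\<tau> > 0"
    and \<phi>0: "\<phi>0 \<in> Vh a l \<T>" and \<phi>1: "\<phi>1 \<in> Vh a l \<T>" and \<phi>s: "\<phi>s \<in> Vh a l \<T>"
    and \<theta>0: "\<theta>0 \<in> Vhp a l \<T>" and \<theta>1: "\<theta>1 \<in> Vhp a l \<T>" and \<theta>s: "\<theta>s \<in> Vhp a l \<T>"
    and \<mu>1: "\<mu>1 \<in> Vh a l \<T>" and \<mu>s: "\<mu>s \<in> Vh a l \<T>" and \<pi>1: "\<pi>1 \<in> Qh a l \<T>"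
    and u0: "u0 \<in> Xh a l \<T>" and u1: "u1 \<in> Xh a l \<T>" and uh: "uh \<in> Xh a l \<T>" and uh_mid: "uh = mid u0 u1"
    and phase: "\<And>\<psi>. \<psi> \<in> Vh a l \<T> \<Longrightarrow> phase_eq M (cube a l) \<tau> \<phi>0 \<phi>1 \<phi>s uh \<theta>1 \<theta>s \<mu>1 \<psi>"
    and potential: "\<And>\<xi>. \<xi> \<in> Vh a l \<T> \<Longrightarrow> potential_eq M (cube a l) \<phi>0 \<phi>1 \<theta>1 \<mu>1 \<xi>"
    and energy: "\<And>w. w \<in> Vhp a l \<T> \<Longrightarrow> energy_eq M (cube a l) \<tau> \<phi>0 \<phi>1 \<phi>s uh \<theta>0 \<theta>1 \<theta>s \<mu>1 \<mu>s w"
    and momentum: "\<And>v. v \<in> Xh a l \<T> \<Longrightarrow> momentum_eq M (cube a l) \<tau> \<phi>s u0 u1 us uh \<theta>1 \<theta>s \<mu>1 \<mu>s \<pi>1 v"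
    and incompressible: "\<And>q. q \<in> Qh a l \<T> \<Longrightarrow> 0 = ip (cube a l) (dvg uh) q"
begin

abbreviation "visc_s x \<equiv> visc M (\<phi>s x) (\<theta>s x)"
abbreviation "L11_s x \<equiv> L11 M (\<phi>s x) (grad \<phi>s x) (\<theta>s x)"
abbreviation "L12_s x \<equiv> L12 M (\<phi>s x) (grad \<phi>s x) (\<theta>s x)"
abbreviation "L22_s x \<equiv> L22 M (\<phi>s x) (grad \<phi>s x) (\<theta>s x)"
abbreviation "LINT\<Omega> f \<equiv> LINT x:\<Omega>|lebesgue. f x"

lemmas pwc_facts =
  Vh_pwc[OF \<phi>0] Vh_pwc[OF \<phi>1] Vh_pwc[OF \<phi>s] Vh_pwc[OF \<mu>1] Vh_pwc[OF \<mu>s]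
  Vh_pwc_grad[OF \<phi>0] Vh_pwc_grad[OF \<phi>1] Vh_pwc_grad[OF \<phi>s] Vh_pwc_grad[OF \<mu>1]
  Vh_pwc_grad[OF Vhp_imp_Vh[OF \<theta>1]]
  Vhp_pwc[OF \<theta>0] Vhp_pwc[OF \<theta>1] Vhp_pwc[OF \<theta>s]
  pwc_weaken[OF Vhp_pwc[OF \<theta>0]] pwc_weaken[OF Vhp_pwc[OF \<theta>1]] pwc_weaken[OF Vhp_pwc[OF \<theta>s]]
  pwc_Xh[OF u0] pwc_Xh[OF u1] pwc_Xh[OF uh] pwc_Dsym[OF uh]
  pwc_visc[OF \<phi>s \<theta>s] pwc_L11[OF \<phi>s \<theta>s] pwc_L12[OF \<phi>s \<theta>s] pwc_L22[OF \<phi>s \<theta>s]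
  pwc_energy[OF \<phi>0 \<theta>0] pwc_energy[OF \<phi>1 \<theta>1]
  pwc_entropy[OF \<phi>0 \<theta>0] pwc_entropy[OF \<phi>1 \<theta>1] pwc_entropy[OF \<phi>s \<theta>s]
  pwc_remainder[OF \<phi>0 \<phi>1 \<theta>0 \<theta>1]

lemma \<theta>1_pos: "x \<in> \<Omega> \<Longrightarrow> \<theta>1 x > 0" and \<theta>0_pos: "x \<in> \<Omega> \<Longrightarrow> \<theta>0 x > 0" and \<theta>s_pos: "x \<in> \<Omega> \<Longrightarrow> \<theta>s x > 0"
  using \<theta>0 \<theta>1 \<theta>s by (auto simp: Vhp_def)

lemma mass_balance: "LINT\<Omega> (\<lambda>x. \<phi>1 x - \<phi>0 x) = 0"
proof -
  have "ip \<Omega> (dtau \<tau> \<phi>0 \<phi>1) (\<lambda>x. 1) = 0"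
    using phase[OF Vhp_imp_Vh[OF one_in_Vhp]] by (simp add: phase_eq_def grad_const ip_def set_lebesgue_integral_def)
  moreover have "ip \<Omega> (dtau \<tau> \<phi>0 \<phi>1) (\<lambda>x. 1) = (1 / \<tau>) * LINT\<Omega> (\<lambda>x. \<phi>1 x - \<phi>0 x)"
    unfolding ip_def dtau_def by (simp add: set_integral_mult_right[symmetric] del: set_integral_mult_right)
  ultimately show ?thesis
    using \<tau> by simp
qed

lemma energy_balance:
  "LINT\<Omega> (\<lambda>x. ((1/2) * (norm (u1 x))\<^sup>2 + energy M \<phi>1 \<theta>1 x) - ((1/2) * (norm (u0 x))\<^sup>2 + energy M \<phi>0 \<theta>0 x)) = 0"
proof -
  let ?A = "\<lambda>x. (\<phi>s x / \<theta>1 x) *\<^sub>R grad \<mu>1 x - sigma M \<phi>s \<theta>s x *v ((1 / \<theta>1 x) *\<^sub>R grad \<theta>1 x)"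
  let ?q = "\<lambda>x. entropy M \<phi>s \<theta>s x + \<phi>s x * \<mu>s x"
  \<comment> \<open>The midpoint rule makes this exact: the increment \<open>u1 - u0\<close> paired
    with half of \<open>u1 + u0\<close> is a difference of halved squares.\<close>
  have K_u: "ip \<Omega> (dtau \<tau> u0 u1) uh = (1/\<tau>) * LINT\<Omega> (\<lambda>x. (1/2) * (norm (u1 x))\<^sup>2 - (1/2) * (norm (u0 x))\<^sup>2)"
    unfolding ip_def set_integral_mult_right[symmetric] uh_mid dtau_def mid_def
    by (simp add: power2_norm_eq_inner inner_diff_left inner_add_right inner_commute algebra_simps)
  have K_e: "ip \<Omega> (dtau \<tau> (energy M \<phi>0 \<theta>0) (energy M \<phi>1 \<theta>1)) (\<lambda>x. 1)
      = (1/\<tau>) * LINT\<Omega> (\<lambda>x. energy M \<phi>1 \<theta>1 x - energy M \<phi>0 \<theta>0 x)"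
    unfolding ip_def set_integral_mult_right[symmetric] dtau_def by simp
  \<comment> \<open>The pressure itself is an admissible test function in the divergence
    constraint.\<close>
  have K_pi: "ip \<Omega> \<pi>1 (dvg uh) = 0"
    using incompressible[OF \<pi>1] by (simp add: ip_def mult.commute)
  \<comment> \<open>The two halves of the skew form coincide when its last two arguments agree,
    whatever the transporting velocity is.\<close>
  have K_c: "cskw \<Omega> us uh uh = 0"
    by (simp add: cskw_def)
  have K_D: "ip \<Omega> (\<lambda>x. visc_s x *\<^sub>R Dsym uh x) (Dsym uh) = ip \<Omega> (\<lambda>x. visc_s x * (norm (Dsym uh x))\<^sup>2) (\<lambda>x. 1)"
    by (simp add: ip_def power2_norm_eq_inner)
  \<comment> \<open>The right-hand side keeps the literal shape of \<open>energy_eq\<close> for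
    \<open>w = 1\<close>, redundant factors 0 and 1 included, so that the final linear arithmetic
    recognises the terms as equal.\<close>
  have K_q: "ip \<Omega> (\<lambda>x. ?A x - (?q x / (\<theta>s x)\<^sup>2) *\<^sub>R grad \<theta>1 x) uh
      = ip \<Omega> ?A (\<lambda>x. 1 *\<^sub>R uh x)
        + ip \<Omega> (\<lambda>x. ?q x *\<^sub>R uh x) (\<lambda>x. (1 / (\<theta>s x)\<^sup>2) *\<^sub>R (\<theta>1 x *\<^sub>R 0 - 1 *\<^sub>R grad \<theta>1 x))"
  proof -
    have "pwc \<T> UNIV (\<lambda>x. ?A x \<bullet> uh x)" "pwc \<T> UNIV (\<lambda>x. ?q x / (\<theta>s x)\<^sup>2 * (grad \<theta>1 x \<bullet> uh x))"
      by (intro pwc_rules pwc_sigma_mult[OF \<phi>s \<theta>s] pwc_facts)+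
    note pwc_integral_diff[OF this]
    moreover have "ip \<Omega> (\<lambda>x. ?q x *\<^sub>R uh x) (\<lambda>x. (1 / (\<theta>s x)\<^sup>2) *\<^sub>R (\<theta>1 x *\<^sub>R 0 - 1 *\<^sub>R grad \<theta>1 x))
      = - LINT\<Omega> (\<lambda>x. ?q x / (\<theta>s x)\<^sup>2 * (grad \<theta>1 x \<bullet> uh x))"
      unfolding ip_def by (simp add: inner_commute set_integral_uminus[symmetric] set_lebesgue_integral_def)
    ultimately show ?thesis
      unfolding ip_def by (simp add: inner_diff_left)
  qed
  have K_0: "ip \<Omega> f (\<lambda>x. 0) = 0" for f :: "real^'d \<Rightarrow> real^'d"
    by (simp add: ip_def set_lebesgue_integral_def)
  have "(1/\<tau>) * LINT\<Omega> (\<lambda>x. (1/2) * (norm (u1 x))\<^sup>2 - (1/2) * (norm (u0 x))\<^sup>2)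
      + (1/\<tau>) * LINT\<Omega> (\<lambda>x. energy M \<phi>1 \<theta>1 x - energy M \<phi>0 \<theta>0 x) = 0"
    using momentum[OF uh, unfolded momentum_eq_def K_u K_c K_pi K_D K_q]
      energy[OF one_in_Vhp, unfolded energy_eq_def grad_const K_e K_0]
    by linarith
  then have sum_0: "LINT\<Omega> (\<lambda>x. (1/2) * (norm (u1 x))\<^sup>2 - (1/2) * (norm (u0 x))\<^sup>2)
      + LINT\<Omega> (\<lambda>x. energy M \<phi>1 \<theta>1 x - energy M \<phi>0 \<theta>0 x) = 0"
    using \<tau> by (simp add: add_divide_distrib[symmetric])
  have "pwc \<T> UNIV (\<lambda>x. (1/2) * (norm (u1 x))\<^sup>2 - (1/2) * (norm (u0 x))\<^sup>2)"
    "pwc \<T> UNIV (\<lambda>x. energy M \<phi>1 \<theta>1 x - energy M \<phi>0 \<theta>0 x)"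
    by (intro pwc_rules pwc_facts)+
  from pwc_integral_add[OF this] show ?thesis
    unfolding sum_0 by (simp only: algebra_simps)
qed

text \<open>Rewrites the dissipation into precisely the terms produced by the energy equation tested
  with \<open>\<theta>1\<close> and the phase equation tested with \<open>\<mu>1\<close>. Positive
  viscosity and temperature allow the square root to be squared away.\<close>

lemma dissipation_eq:
  "dissipation M \<Omega> \<phi>s \<theta>s uh \<mu>1 \<theta>1
   = ip \<Omega> (\<lambda>x. visc_s x * (norm (Dsym uh x))\<^sup>2) \<theta>1
     + ip \<Omega> (\<lambda>x. L11_s x *v grad \<mu>1 x - L12_s x *v grad \<theta>1 x) (grad \<mu>1)
     - ip \<Omega> (\<lambda>x. L12_s x *v grad \<mu>1 x - L22_s x *v grad \<theta>1 x) (grad \<theta>1)"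
proof -
  let ?f = "\<lambda>x. sqrt (visc_s x * \<theta>1 x) *\<^sub>R Dsym uh x"
  have "ip \<Omega> ?f ?f \<ge> 0"
    unfolding ip_def set_lebesgue_integral_def by (intro Bochner_Integration.integral_nonneg)
      (simp del: inner_scaleR_left inner_scaleR_right)
  then have "(norm0 \<Omega> ?f)\<^sup>2 = ip \<Omega> ?f ?f"
    by (simp add: norm0_def)
  also have "\<dots> = ip \<Omega> (\<lambda>x. visc_s x * (norm (Dsym uh x))\<^sup>2) \<theta>1"
    unfolding ip_def
  proof (rule set_lebesgue_integral_cong[OF cube_sets], intro allI impI)
    fix x assume "x \<in> \<Omega>"
    then have "visc_s x * \<theta>1 x \<ge> 0"
      using visc_pos \<theta>1_pos \<theta>s_pos by (simp add: less_imp_le)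
    then have "sqrt (visc_s x * \<theta>1 x) * sqrt (visc_s x * \<theta>1 x) = visc_s x * \<theta>1 x"
      by simp
    moreover have "?f x \<bullet> ?f x = (sqrt (visc_s x * \<theta>1 x) * sqrt (visc_s x * \<theta>1 x)) * (norm (Dsym uh x))\<^sup>2"
      by (simp only: inner_scaleR_left inner_scaleR_right power2_norm_eq_inner mult.assoc)
    ultimately show "?f x \<bullet> ?f x = (visc_s x * (norm (Dsym uh x))\<^sup>2) \<bullet> \<theta>1 x"
      by (simp only: inner_real_def mult_ac)
  qed
  finally have 1: "(norm0 \<Omega> ?f)\<^sup>2 = ip \<Omega> (\<lambda>x. visc_s x * (norm (Dsym uh x))\<^sup>2) \<theta>1" .
  have "pwc \<T> UNIV (\<lambda>x. (L11_s x *v grad \<mu>1 x - L12_s x *v grad \<theta>1 x) \<bullet> grad \<mu>1 x)"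
    "pwc \<T> UNIV (\<lambda>x. (L12_s x *v grad \<mu>1 x - L22_s x *v grad \<theta>1 x) \<bullet> grad \<theta>1 x)"
    by (intro pwc_rules pwc_facts)+
  from pwc_integral_diff[OF this] 1 show ?thesis
    unfolding dissipation_def Lmat_quadratic_form ip_def by simp
qed

lemma entropy_balance:
  "LINT\<Omega> (\<lambda>x. entropy M \<phi>1 \<theta>1 x - entropy M \<phi>0 \<theta>0 x)
   = \<tau> * dissipation M \<Omega> \<phi>s \<theta>s uh \<mu>1 \<theta>1 + LINT\<Omega> (remainder \<phi>0 \<phi>1 \<theta>0 \<theta>1)"
proof -
  define d\<phi>h where "d\<phi>h = (\<lambda>x. \<phi>1 x - \<phi>0 x)"
  have d\<phi>h: "d\<phi>h \<in> Vh a l \<T>"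
    using \<phi>0 \<phi>1 by (simp add: d\<phi>h_def Vh_def fe_space_diff)
  let ?p = "\<lambda>x. d\<phi> (Psivex M) (\<phi>1 x) (\<theta>1 x) + d\<phi> (Psicav M) (\<phi>0 x) (\<theta>1 x)"
  let ?R = "remainder \<phi>0 \<phi>1 \<theta>0 \<theta>1"
  let ?X = "LINT\<Omega> (\<lambda>x. \<theta>1 x * (energy M \<phi>1 \<theta>1 x - energy M \<phi>0 \<theta>0 x))"
  let ?E4 = "ip \<Omega> (\<lambda>x. sigma M \<phi>s \<theta>s x *v uh x) (grad \<theta>1)"
  let ?E5 = "ip \<Omega> (\<lambda>x. (\<phi>s x / \<theta>1 x) *\<^sub>R grad \<mu>1 x - sigma M \<phi>s \<theta>s x *v ((1 / \<theta>1 x) *\<^sub>R grad \<theta>1 x))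
      (\<lambda>x. \<theta>1 x *\<^sub>R uh x)"
  let ?P2 = "ip \<Omega> (\<lambda>x. \<phi>s x *\<^sub>R uh x) (grad \<mu>1)"
  have pwc_p: "pwc \<T> UNIV ?p"
    by (intro pwc_add pwc_state[OF \<phi>1 \<theta>1 C2_on_partials(4)[OF C2_vex]]
        pwc_state[OF \<phi>0 \<theta>1 C2_on_partials(4)[OF C2_cav]])
  have "ip \<Omega> (dtau \<tau> (energy M \<phi>0 \<theta>0) (energy M \<phi>1 \<theta>1)) \<theta>1 = (1/\<tau>) * ?X"
    unfolding ip_def set_integral_mult_right[symmetric] dtau_def by (simp add: mult_ac)
  then have EX: "\<tau> * ip \<Omega> (dtau \<tau> (energy M \<phi>0 \<theta>0) (energy M \<phi>1 \<theta>1)) \<theta>1 = ?X"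
    using \<tau> by simp
  have "ip \<Omega> (dtau \<tau> \<phi>0 \<phi>1) \<mu>1 = (1/\<tau>) * ip \<Omega> \<mu>1 d\<phi>h"
    unfolding ip_def set_integral_mult_right[symmetric] dtau_def d\<phi>h_def by (simp add: mult_ac)
  then have PQ: "\<tau> * ip \<Omega> (dtau \<tau> \<phi>0 \<phi>1) \<mu>1 = ip \<Omega> \<mu>1 d\<phi>h"
    using \<tau> by simp
  \<comment> \<open>The weight \<open>\<theta>1\<close> cancels the denominators, and the rank-one
    tensor \<sigma>, being symmetric, moves from the temperature gradient to the velocity.\<close>
  have E5: "?E5 = ?P2 - ?E4"
  proof -
    have pw: "pwc \<T> UNIV (\<lambda>x. (\<phi>s x *\<^sub>R uh x) \<bullet> grad \<mu>1 x)" "pwc \<T> UNIV (\<lambda>x. (sigma M \<phi>s \<theta>s x *v uh x) \<bullet> grad \<theta>1 x)"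
      by (intro pwc_rules pwc_sigma_mult[OF \<phi>s \<theta>s] pwc_facts)+
    have "?E5 = LINT\<Omega> (\<lambda>x. (\<phi>s x *\<^sub>R uh x) \<bullet> grad \<mu>1 x - (sigma M \<phi>s \<theta>s x *v uh x) \<bullet> grad \<theta>1 x)"
    proof (rule ip_cong)
      show "pwc \<T> UNIV (\<lambda>x. (\<phi>s x *\<^sub>R uh x) \<bullet> grad \<mu>1 x - (sigma M \<phi>s \<theta>s x *v uh x) \<bullet> grad \<theta>1 x)"
        using pw by (rule pwc_diff)
      fix x assume "x \<in> \<Omega>o"
      then have "\<theta>1 x > 0"
        using cell_interior_subset \<theta>1_pos by blast
      then show "(\<phi>s x *\<^sub>R uh x) \<bullet> grad \<mu>1 x - (sigma M \<phi>s \<theta>s x *v uh x) \<bullet> grad \<theta>1 x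
        = ((\<phi>s x / \<theta>1 x) *\<^sub>R grad \<mu>1 x - sigma M \<phi>s \<theta>s x *v ((1 / \<theta>1 x) *\<^sub>R grad \<theta>1 x)) \<bullet> (\<theta>1 x *\<^sub>R uh x)"
        unfolding sigma_vector_mult
        by (simp add: inner_diff_left inner_diff_right inner_commute right_diff_distrib)
    qed
    also have "\<dots> = ?P2 - ?E4"
      unfolding ip_def using pw by (rule pwc_integral_diff)
    finally show ?thesis .
  qed
  \<comment> \<open>For \<open>w = \<theta>1\<close> the two products in the numerator
    coincide.\<close>
  have E6: "ip \<Omega> (\<lambda>x. (entropy M \<phi>s \<theta>s x + \<phi>s x * \<mu>s x) *\<^sub>R uh x)
      (\<lambda>x. (1 / (\<theta>s x)\<^sup>2) *\<^sub>R (\<theta>1 x *\<^sub>R grad \<theta>1 x - \<theta>1 x *\<^sub>R grad \<theta>1 x)) = 0"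
    by (simp add: ip_def set_lebesgue_integral_def)
  \<comment> \<open>The temperature part uses the discrete product rule:
    \<open>\<theta>1 e1 - \<theta>0 e0\<close> equals
    \<open>\<theta>1 (e1 - e0) + e0 (\<theta>1 - \<theta>0)\<close>, and the last product is the
    linear Taylor term inside \<open>remainder\<close>. The convex-concave splitting is unfolded at
    temperature \<open>\<theta>1\<close> only; the value of \<Psi> at the old state occurs once on
    each side.\<close>
  have "LINT\<Omega> (\<lambda>x. entropy M \<phi>1 \<theta>1 x - entropy M \<phi>0 \<theta>0 x)
      = LINT\<Omega> (\<lambda>x. \<theta>1 x * (energy M \<phi>1 \<theta>1 x - energy M \<phi>0 \<theta>0 x) - ?p x \<bullet> d\<phi>h x
          - gam M * (grad \<phi>1 x \<bullet> grad d\<phi>h x) + ?R x)"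
  proof (rule pwc_integral_cong)
    show "pwc \<T> UNIV (\<lambda>x. entropy M \<phi>1 \<theta>1 x - entropy M \<phi>0 \<theta>0 x)"
      by (intro pwc_rules pwc_facts)
    fix x assume x: "x \<in> \<Omega>o"
    then have "x \<in> \<Omega>"
      using cell_interior_subset by blast
    note pos = \<theta>0_pos[OF this] \<theta>1_pos[OF this]
    have g: "grad (\<lambda>y. \<phi>1 y - \<phi>0 y) x = grad \<phi>1 x - grad \<phi>0 x"
      using grad_diff[OF _ _ x] \<phi>0 \<phi>1 unfolding Vh_def by blast
    have n: "(norm (grad \<phi>1 x - grad \<phi>0 x))\<^sup>2
        = (norm (grad \<phi>1 x))\<^sup>2 - 2 * (grad \<phi>1 x \<bullet> grad \<phi>0 x) + (norm (grad \<phi>0 x))\<^sup>2"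
      by (simp add: power2_norm_eq_inner inner_diff_left inner_diff_right inner_commute)
    have i: "grad \<phi>1 x \<bullet> (grad \<phi>1 x - grad \<phi>0 x) = (norm (grad \<phi>1 x))\<^sup>2 - grad \<phi>1 x \<bullet> grad \<phi>0 x"
      by (simp add: power2_norm_eq_inner inner_diff_right)
    show "entropy M \<phi>1 \<theta>1 x - entropy M \<phi>0 \<theta>0 x
        = \<theta>1 x * (energy M \<phi>1 \<theta>1 x - energy M \<phi>0 \<theta>0 x) - ?p x \<bullet> d\<phi>h x
          - gam M * (grad \<phi>1 x \<bullet> grad d\<phi>h x) + ?R x"
      unfolding entropy_def Psitilde_def remainder_def d\<phi>h_def g energy_def n i inner_real_def split[OF pos(2)]
      by (simp add: field_simps)
  qed
  also have "\<dots> = ?X - ip \<Omega> ?p d\<phi>h - gam M * ip \<Omega> (grad \<phi>1) (grad d\<phi>h) + LINT\<Omega> ?R"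
  proof -
    have pw: "pwc \<T> UNIV (\<lambda>x. \<theta>1 x * (energy M \<phi>1 \<theta>1 x - energy M \<phi>0 \<theta>0 x))"
      "pwc \<T> UNIV (\<lambda>x. ?p x \<bullet> d\<phi>h x)" "pwc \<T> UNIV (\<lambda>x. gam M * (grad \<phi>1 x \<bullet> grad d\<phi>h x))"
      by (intro pwc_rules[of \<T>] pwc_p Vh_pwc[OF d\<phi>h] Vh_pwc_grad[OF d\<phi>h] pwc_facts)+
    show ?thesis
      unfolding ip_def set_integral_mult_right[symmetric]
      using pwc_integral_add[OF pwc_diff[OF pwc_diff[OF pw(1,2)] pw(3)] pwc_remainder[OF \<phi>0 \<phi>1 \<theta>0 \<theta>1]]
        pwc_integral_diff[OF pwc_diff[OF pw(1,2)] pw(3)] pwc_integral_diff[OF pw(1,2)] by simp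
  qed
  finally have "LINT\<Omega> (\<lambda>x. entropy M \<phi>1 \<theta>1 x - entropy M \<phi>0 \<theta>0 x) = ?X - ip \<Omega> \<mu>1 d\<phi>h + LINT\<Omega> ?R"
    using potential[OF d\<phi>h] unfolding potential_eq_def by linarith
  \<comment> \<open>By \<open>E5\<close> the stress terms in the energy equation cancel and
    \<open>?P2\<close> is left over; the same \<open>?P2\<close> occurs in the phase equation and
    drops out of the difference.\<close>
  moreover have "?X - ip \<Omega> \<mu>1 d\<phi>h = \<tau> * dissipation M \<Omega> \<phi>s \<theta>s uh \<mu>1 \<theta>1"
  proof -
    have "ip \<Omega> (dtau \<tau> (energy M \<phi>0 \<theta>0) (energy M \<phi>1 \<theta>1)) \<theta>1 - ip \<Omega> (dtau \<tau> \<phi>0 \<phi>1) \<mu>1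
        = dissipation M \<Omega> \<phi>s \<theta>s uh \<mu>1 \<theta>1"
      using phase[OF \<mu>1] energy[OF \<theta>1] E5 E6 unfolding phase_eq_def energy_eq_def dissipation_eq by linarith
    then show ?thesis
      unfolding EX[symmetric] PQ[symmetric] by (simp add: right_diff_distrib[symmetric])
  qed
  ultimately show ?thesis
    by simp
qed

end

section \<open>Summation over the time steps\<close>

theorem theorem1:
  fixes M :: "('d::finite) model"
    and a :: "real^'d" and l \<tau> :: real and \<T> :: "(real^'d) set set" and N :: nat
    and ts :: "nat \<Rightarrow> real"
    and \<phi> \<mu> \<pi> \<theta> :: "real \<Rightarrow> real^'d \<Rightarrow> real" and u :: "real \<Rightarrow> real^'d \<Rightarrow> real^'d"
  defines "\<Omega> \<equiv> cube a l"
    and "t \<equiv> \<lambda>n::nat. real n * \<tau>"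
  assumes dim: "CARD('d) = 2 \<or> CARD('d) = 3"
    and l: "l > 0"
    and mesh: "periodic_mesh a l \<T>"
    and \<tau>: "\<tau> > 0"
    and A1: "gam M > 0"
    and A2: "\<And>p r. r > 0 \<Longrightarrow> visc M p r > 0"
    and A3_sym: "\<And>p g r. r > 0 \<Longrightarrow> transpose (Lmat M p g r) = Lmat M p g r"
    and A3_pos: "\<And>p g r z. r > 0 \<Longrightarrow> z \<noteq> 0 \<Longrightarrow> z \<bullet> (Lmat M p g r *v z) > 0"
    and A3_L12: "\<And>p g r. r > 0 \<Longrightarrow> transpose (L12 M p g r) = L12 M p g r"
    and A4_concave: "\<And>p. concave_on {0<..} (Psi M p)"
    and A4_blowup: "\<And>p. filterlim (\<lambda>r. \<bar>Psi M p r\<bar>) at_top (at_right 0)"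
    and A4_split: "\<And>p r. r > 0 \<Longrightarrow> Psi M p r = Psivex M p r + Psicav M p r"
    and A4_vex: "\<And>r. r > 0 \<Longrightarrow> strictly_convex_on UNIV (\<lambda>p. Psivex M p r)"
    and A4_cav: "\<And>r. r > 0 \<Longrightarrow> strictly_concave_on UNIV (\<lambda>p. Psicav M p r)"
    and C2_Psi: "C2_on (UNIV \<times> {0<..}) (\<lambda>(p, r). Psi M p r)"
    and C2_vex: "C2_on (UNIV \<times> {0<..}) (\<lambda>(p, r). Psivex M p r)"
    and C2_cav: "C2_on (UNIV \<times> {0<..}) (\<lambda>(p, r). Psicav M p r)"
    and C1_visc: "C1_on (UNIV \<times> {0<..}) (\<lambda>(p, r). visc M p r)"
    and C1_L: "C1_on (UNIV \<times> UNIV \<times> {0<..}) (\<lambda>(p, g, r). Lmat M p g r)"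
    and ts: "\<And>n. n < N \<Longrightarrow> ts n \<in> {t n, t (Suc n)}"
    and sol: "scheme_solution M a l \<T> \<tau> N ts \<phi> \<mu> u \<pi> \<theta>"
  shows "(\<forall>n<N.
            ip \<Omega> (\<lambda>x. \<phi> (t (Suc n)) x - \<phi> (t 0) x) (\<lambda>_. 1) = 0 \<and>
            ip \<Omega> (\<lambda>x. (1/2) * (norm (u (t (Suc n)) x))\<^sup>2 + energy M (\<phi> (t (Suc n))) (\<theta> (t (Suc n))) x
                     - (1/2) * (norm (u (t 0) x))\<^sup>2 - energy M (\<phi> (t 0)) (\<theta> (t 0)) x) (\<lambda>_. 1) = 0)
       \<and> (\<exists>(\<xi>1 :: nat \<Rightarrow> real^'d \<Rightarrow> real) (\<xi>2 :: nat \<Rightarrow> real^'d \<Rightarrow> real) (\<xi>3 :: nat \<Rightarrow> real^'d \<Rightarrow> real)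
             (Dnum :: nat \<Rightarrow> real).
            (\<forall>k<N.
               (\<forall>x\<in>\<Omega>. \<xi>1 k x \<in> closed_segment (\<phi> (t (Suc k)) x) (\<phi> (t k) x) \<and>
                       \<xi>2 k x \<in> closed_segment (\<phi> (t (Suc k)) x) (\<phi> (t k) x) \<and>
                       \<xi>3 k x \<in> closed_segment (\<theta> (t (Suc k)) x) (\<theta> (t k) x)) \<and>
               set_integrable lebesgue \<Omega> (num_diss_density M (\<phi> (t k)) (\<phi> (t (Suc k)))
                 (\<theta> (t k)) (\<theta> (t (Suc k))) (\<xi>1 k) (\<xi>2 k) (\<xi>3 k)) \<and>
               Dnum k = (LINT x:\<Omega>|lebesgue. num_diss_density M (\<phi> (t k)) (\<phi> (t (Suc k)))
                 (\<theta> (t k)) (\<theta> (t (Suc k))) (\<xi>1 k) (\<xi>2 k) (\<xi>3 k) x) \<and>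
               0 \<le> Dnum k) \<and>
            (\<forall>n<N.
               ip \<Omega> (\<lambda>x. entropy M (\<phi> (t (Suc n))) (\<theta> (t (Suc n))) x
                        - entropy M (\<phi> (t 0)) (\<theta> (t 0)) x) (\<lambda>_. 1)
               = \<tau> * (\<Sum>k\<le>n. dissipation M \<Omega> (\<phi> (ts k)) (\<theta> (ts k)) (mid (u (t k)) (u (t (Suc k))))
                              (\<mu> (t (Suc k))) (\<theta> (t (Suc k))))
                 + (\<Sum>k\<le>n. Dnum k)))"
proof -
  let ?step = "\<lambda>n. scheme_step a l \<T> M \<tau> (\<phi> (t n)) (\<phi> (t (Suc n))) (\<phi> (ts n)) (\<theta> (t n)) (\<theta> (t (Suc n))) (\<theta> (ts n))
    (\<mu> (t (Suc n))) (\<mu> (ts n)) (\<pi> (t (Suc n))) (u (t n)) (u (t (Suc n))) (u (ts n)) (mid (u (t n)) (u (t (Suc n))))"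
  interpret discretised_model a l \<T> M
    by unfold_locales (rule mesh A2 A1 A4_concave A4_split A4_vex A4_cav C2_Psi C2_vex C2_cav C1_visc C1_L; assumption)+
  let ?R = "\<lambda>k. remainder (\<phi> (t k)) (\<phi> (t (Suc k))) (\<theta> (t k)) (\<theta> (t (Suc k)))"
  have time: "t n \<in> {0..real N * \<tau>}" if "n \<le> N" for n
    using that \<tau> by (simp add: t_def mult_right_mono)
  have time_pos: "t (Suc n) \<in> {0<..real N * \<tau>}" if "n < N" for n
    using time[of "Suc n"] that \<tau> by (simp add: t_def)
  have time_ts: "ts n \<in> {0..real N * \<tau>}" if "n < N" for n
    using time[of n] time[of "Suc n"] ts[OF that] that by auto
  have \<phi>V: "\<phi> s \<in> Vh a l \<T>" and uV: "u s \<in> Xh a l \<T>" and \<theta>V: "\<theta> s \<in> Vhp a l \<T>" if "s \<in> {0..real N * \<tau>}" for s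
    using sol that by (auto simp: scheme_solution_def Pi1c_def)
  have \<mu>V: "\<mu> s \<in> Vh a l \<T>" and \<pi>V: "\<pi> s \<in> Qh a l \<T>" if "s \<in> {0<..real N * \<tau>}" for s
    using sol that by (auto simp: scheme_solution_def Pi0_def)
  \<comment> \<open>\<open>Pi0\<close> constrains \<mu> at positive times only. A starred time 0 can
    occur in the first step alone, where the prescribed initial value is in the space by the
    definition of a solution.\<close>
  have \<mu>sV: "\<mu> (ts n) \<in> Vh a l \<T>" if n: "n < N" for n
  proof (cases "ts n = 0")
    case True
    then have "n = 0"
      using ts[OF n] \<tau> by (auto simp: t_def)
    then show ?thesis
      using True sol by (simp add: scheme_solution_def)
  next
    case False
    then show ?thesis
      using \<mu>V time_ts[OF n] by simp
  qed
  \<comment> \<open>The midpoint velocity is a value of the piecewise linear function \<open>u\<close>, hence in \<open>Xh\<close>.\<close>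
  have mid_eq: "mid (u (t n)) (u (t (Suc n))) = u ((real n + 1/2) * \<tau>)" if "n < N" for n
  proof
    fix x
    have "u ((real n + 1/2) * \<tau>) x = (1 - 1/2) *\<^sub>R u (real n * \<tau>) x + (1/2) *\<^sub>R u (real (Suc n) * \<tau>) x"
      using sol that unfolding scheme_solution_def Pi1c_def by force
    then show "mid (u (t n)) (u (t (Suc n))) x = u ((real n + 1/2) * \<tau>) x"
      by (simp add: mid_def t_def scaleR_add_right add.commute)
  qed
  have midV: "mid (u (t n)) (u (t (Suc n))) \<in> Xh a l \<T>" if "n < N" for n
    unfolding mid_eq[OF that] using that \<tau> by (intro uV) (auto intro!: mult_right_mono)
  have step: "?step n" if n: "n < N" for n
  proof -
    note times = time[OF less_imp_le[OF n]] time[OF Suc_leI[OF n]] time_ts[OF n]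
    let ?uh = "mid (u (t n)) (u (t (Suc n)))"
    have eqs: "(\<forall>\<psi>\<in>Vh a l \<T>. phase_eq M \<Omega> \<tau> (\<phi> (t n)) (\<phi> (t (Suc n))) (\<phi> (ts n)) ?uh
            (\<theta> (t (Suc n))) (\<theta> (ts n)) (\<mu> (t (Suc n))) \<psi>) \<and>
        (\<forall>\<xi>\<in>Vh a l \<T>. potential_eq M \<Omega> (\<phi> (t n)) (\<phi> (t (Suc n))) (\<theta> (t (Suc n))) (\<mu> (t (Suc n))) \<xi>) \<and>
        (\<forall>w\<in>Vhp a l \<T>. energy_eq M \<Omega> \<tau> (\<phi> (t n)) (\<phi> (t (Suc n))) (\<phi> (ts n)) ?uh
            (\<theta> (t n)) (\<theta> (t (Suc n))) (\<theta> (ts n)) (\<mu> (t (Suc n))) (\<mu> (ts n)) w) \<and>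
        (\<forall>v\<in>Xh a l \<T>. momentum_eq M \<Omega> \<tau> (\<phi> (ts n)) (u (t n)) (u (t (Suc n))) (u (ts n)) ?uh
            (\<theta> (t (Suc n))) (\<theta> (ts n)) (\<mu> (t (Suc n))) (\<mu> (ts n)) (\<pi> (t (Suc n))) v) \<and>
        (\<forall>q\<in>Qh a l \<T>. 0 = ip \<Omega> (dvg ?uh) q)"
      using sol n unfolding scheme_solution_def Let_def t_def \<Omega>_def by blast
    show ?thesis
      by unfold_locales
        (use \<tau> \<phi>V[OF times(1)] \<phi>V[OF times(2)] \<phi>V[OF times(3)]
            \<theta>V[OF times(1)] \<theta>V[OF times(2)] \<theta>V[OF times(3)]
            \<mu>V[OF time_pos[OF n]] \<mu>sV[OF n] \<pi>V[OF time_pos[OF n]]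
            uV[OF times(1)] uV[OF times(2)] midV[OF n] eqs in \<open>simp_all add: \<Omega>_def\<close>)
  qed
  have conservation: "ip \<Omega> (\<lambda>x. \<phi> (t (Suc n)) x - \<phi> (t 0) x) (\<lambda>_. 1) = 0 \<and>
     ip \<Omega> (\<lambda>x. (1/2) * (norm (u (t (Suc n)) x))\<^sup>2 + energy M (\<phi> (t (Suc n))) (\<theta> (t (Suc n))) x
                - (1/2) * (norm (u (t 0) x))\<^sup>2 - energy M (\<phi> (t 0)) (\<theta> (t 0)) x) (\<lambda>_. 1) = 0"
    if n: "n < N" for n
  proof
    have pw: "pwc \<T> UNIV (\<phi> (t k))" "pwc \<T> UNIV (\<lambda>x. (1/2) * (norm (u (t k) x))\<^sup>2 + energy M (\<phi> (t k)) (\<theta> (t k)) x)"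
      if "k \<le> Suc n" for k
    proof -
      have "t k \<in> {0..real N * \<tau>}"
        using time n that by simp
      note k = \<phi>V[OF this] \<theta>V[OF this] uV[OF this]
      show "pwc \<T> UNIV (\<phi> (t k))"
        by (rule Vh_pwc[OF k(1)])
      show "pwc \<T> UNIV (\<lambda>x. (1/2) * (norm (u (t k) x))\<^sup>2 + energy M (\<phi> (t k)) (\<theta> (t k)) x)"
        by (intro pwc_rules pwc_Xh[OF k(3)] pwc_energy[OF k(1,2)])
    qed
    have "ip \<Omega> (\<lambda>x. \<phi> (t (Suc n)) x - \<phi> (t 0) x) (\<lambda>_. 1) = (\<Sum>k\<le>n. LINT x:\<Omega>|lebesgue. \<phi> (t (Suc k)) x - \<phi> (t k) x)"
      using pwc_integral_telescope[of n "\<lambda>k. \<phi> (t k)"] pw(1) by (simp add: ip_def \<Omega>_def)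
    also have "\<dots> = 0"
      using scheme_step.mass_balance[OF step] n by (simp add: \<Omega>_def)
    finally show "ip \<Omega> (\<lambda>x. \<phi> (t (Suc n)) x - \<phi> (t 0) x) (\<lambda>_. 1) = 0" .
    have "ip \<Omega> (\<lambda>x. (1/2) * (norm (u (t (Suc n)) x))\<^sup>2 + energy M (\<phi> (t (Suc n))) (\<theta> (t (Suc n))) x
                - (1/2) * (norm (u (t 0) x))\<^sup>2 - energy M (\<phi> (t 0)) (\<theta> (t 0)) x) (\<lambda>_. 1)
      = (\<Sum>k\<le>n. LINT x:\<Omega>|lebesgue. ((1/2) * (norm (u (t (Suc k)) x))\<^sup>2 + energy M (\<phi> (t (Suc k))) (\<theta> (t (Suc k))) x)
          - ((1/2) * (norm (u (t k) x))\<^sup>2 + energy M (\<phi> (t k)) (\<theta> (t k)) x))"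
      using pwc_integral_telescope[of n "\<lambda>k x. (1/2) * (norm (u (t k) x))\<^sup>2 + energy M (\<phi> (t k)) (\<theta> (t k)) x"] pw(2)
      by (simp add: ip_def \<Omega>_def diff_diff_eq)
    also have "\<dots> = 0"
      using scheme_step.energy_balance[OF step] n by (intro sum.neutral ballI) (simp add: \<Omega>_def)
    finally show "ip \<Omega> (\<lambda>x. (1/2) * (norm (u (t (Suc n)) x))\<^sup>2 + energy M (\<phi> (t (Suc n))) (\<theta> (t (Suc n))) x
                - (1/2) * (norm (u (t 0) x))\<^sup>2 - energy M (\<phi> (t 0)) (\<theta> (t 0)) x) (\<lambda>_. 1) = 0" .
  qed
  let ?good = "\<lambda>k \<xi>1 \<xi>2 \<xi>3. (\<forall>x\<in>\<Omega>. \<xi>1 x \<in> closed_segment (\<phi> (t (Suc k)) x) (\<phi> (t k) x) \<and>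
       \<xi>2 x \<in> closed_segment (\<phi> (t (Suc k)) x) (\<phi> (t k) x) \<and>
       \<xi>3 x \<in> closed_segment (\<theta> (t (Suc k)) x) (\<theta> (t k) x)) \<and>
     set_integrable lebesgue \<Omega> (num_diss_density M (\<phi> (t k)) (\<phi> (t (Suc k))) (\<theta> (t k)) (\<theta> (t (Suc k))) \<xi>1 \<xi>2 \<xi>3) \<and>
     (LINT x:\<Omega>|lebesgue. num_diss_density M (\<phi> (t k)) (\<phi> (t (Suc k))) (\<theta> (t k)) (\<theta> (t (Suc k))) \<xi>1 \<xi>2 \<xi>3 x)
     = (LINT x:\<Omega>|lebesgue. ?R k x)"
  \<comment> \<open>Intermediate functions are selected for all steps at once, because the
    dissipation of step \<open>k\<close> must not depend on the final index \<open>n\<close> of the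
    entropy balance.\<close>
  have "\<exists>\<xi>1 \<xi>2 \<xi>3. \<forall>k\<in>{..<N}. ?good k (\<xi>1 k) (\<xi>2 k) (\<xi>3 k)"
    unfolding \<Omega>_def
    by (rule choice3, rule num_diss_exists) (auto intro!: \<phi>V \<theta>V time)
  then obtain \<xi>1 \<xi>2 \<xi>3 where \<xi>: "\<forall>k\<in>{..<N}. ?good k (\<xi>1 k) (\<xi>2 k) (\<xi>3 k)"
    by (elim exE)
  have nonneg: "0 \<le> (LINT x:\<Omega>|lebesgue. ?R k x)" if "k < N" for k
    unfolding \<Omega>_def by (rule remainder_integral_nonneg) (use that in \<open>auto intro!: \<theta>V time\<close>)
  have entropy: "ip \<Omega> (\<lambda>x. entropy M (\<phi> (t (Suc n))) (\<theta> (t (Suc n))) x - entropy M (\<phi> (t 0)) (\<theta> (t 0)) x) (\<lambda>_. 1)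
     = \<tau> * (\<Sum>k\<le>n. dissipation M \<Omega> (\<phi> (ts k)) (\<theta> (ts k)) (mid (u (t k)) (u (t (Suc k)))) (\<mu> (t (Suc k))) (\<theta> (t (Suc k))))
       + (\<Sum>k\<le>n. LINT x:\<Omega>|lebesgue. ?R k x)" if n: "n < N" for n
  proof -
    have pw: "pwc \<T> UNIV (entropy M (\<phi> (t k)) (\<theta> (t k)))" if "k \<le> Suc n" for k
      by (intro pwc_entropy \<phi>V \<theta>V time) (use n that in auto)
    have "ip \<Omega> (\<lambda>x. entropy M (\<phi> (t (Suc n))) (\<theta> (t (Suc n))) x - entropy M (\<phi> (t 0)) (\<theta> (t 0)) x) (\<lambda>_. 1)
      = (\<Sum>k\<le>n. LINT x:\<Omega>|lebesgue. entropy M (\<phi> (t (Suc k))) (\<theta> (t (Suc k))) x - entropy M (\<phi> (t k)) (\<theta> (t k)) x)"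
      using pwc_integral_telescope[of n "\<lambda>k. entropy M (\<phi> (t k)) (\<theta> (t k))"] pw by (simp add: ip_def \<Omega>_def)
    also have "\<dots> = (\<Sum>k\<le>n. \<tau> * dissipation M \<Omega> (\<phi> (ts k)) (\<theta> (ts k)) (mid (u (t k)) (u (t (Suc k)))) (\<mu> (t (Suc k))) (\<theta> (t (Suc k)))
        + (LINT x:\<Omega>|lebesgue. ?R k x))"
      unfolding \<Omega>_def by (intro sum.cong refl, rule scheme_step.entropy_balance[OF step]) (use n in simp)
    finally show ?thesis
      by (simp add: sum.distrib sum_distrib_left)
  qed
  \<comment> \<open>The witness for \<open>Dnum\<close> is the integral of \<open>remainder\<close>,
    the form in which nonnegativity and the balance are available; \<xi> identifies it with the
    integral of the density.\<close>
  show ?thesis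
    by (intro conjI allI impI conservation exI[of _ \<xi>1] exI[of _ \<xi>2] exI[of _ \<xi>3]
        exI[of _ "\<lambda>k. LINT x:\<Omega>|lebesgue. ?R k x"]) (use \<xi> nonneg entropy in auto)
qed

end
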